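(* There is a Turing degree that is globally tree surviving but not $2$-surviving. That is, the degree computes a function $A:\omega\to\omega$ which, for every $k$, is not an infinite path through any computable $k$-tree contained in $\omega^{<\omega}$, but every function $f\in 3^\omega$ computable from the degree is an infinite path through some computable $2$-branching subtree of $3^{<\omega}$.
   Context: A tree is a subset of $n^{<\omega}$ or $\omega^{<\omega}$ closed under initial segments. A $k$-branching tree is a tree in which every node has either exactly $1$ or exactly $k$ immediate successors. A $k$-tree is a tree in which every node has at least $1$ and at most $k$ immediate successors. A function $g:\omega\to\omega$ is globally tree surviving if it is not a path through any computable $k$-tree for any $k\in\omega$; a degree is globally tree surviving if it computes such a function. A function $f\in 3^\omega$ is $2$-surviving if it is not a path through any computable $2$-branching subtree of $3^{<\omega}$; a degree is $2$-surviving if it computes such a function. *)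

theory Defs
  imports Main "HOL-Library.Nat_Bijection"
begin

section \<open>Computability relative to an oracle\<close>

text \<open>
  Programs for the unary partial recursive functionals. Several arguments are packed into one
  number with the pairing bijection \<^const>\<open>prod_encode\<close>, so no arities are needed; a
  one-place oracle \<open>g\<close> is a total function on the natural numbers.
\<close>

datatype prog =
    Zero
  | Succ
  | First
  | Second
  | Oracle
  | Fork prog prog
  | Comp prog prog
  | Prec prog prog
  | Mu prog

text \<open>
  \<open>halts_with g p x y\<close> says that program \<open>p\<close> with oracle \<open>g\<close> on input \<open>x\<close> halts with output \<open>y\<close>.
  \<open>Prec p q\<close> is primitive recursion on the second component of the input, with the first component
  as parameter. \<open>Mu p\<close> sends \<open>x\<close> to the least \<open>n\<close> with \<open>p (x, n) = 0\<close>, provided that \<open>p\<close> halts on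
  \<open>(x, m)\<close> for all smaller \<open>m\<close>.
\<close>

inductive halts_with :: "(nat \<Rightarrow> nat) \<Rightarrow> prog \<Rightarrow> nat \<Rightarrow> nat \<Rightarrow> bool" for g :: "nat \<Rightarrow> nat" where
  Zero: "halts_with g Zero x 0"
| Succ: "halts_with g Succ x (Suc x)"
| First: "halts_with g First (prod_encode (x, y)) x"
| Second: "halts_with g Second (prod_encode (x, y)) y"
| Oracle: "halts_with g Oracle x (g x)"
| Fork: "halts_with g p x y \<Longrightarrow> halts_with g q x z \<Longrightarrow> halts_with g (Fork p q) x (prod_encode (y, z))"
| Comp: "halts_with g q x y \<Longrightarrow> halts_with g p y z \<Longrightarrow> halts_with g (Comp p q) x z"
| Prec_0: "halts_with g p x y \<Longrightarrow> halts_with g (Prec p q) (prod_encode (x, 0)) y"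
| Prec_Suc: "halts_with g (Prec p q) (prod_encode (x, n)) y \<Longrightarrow>
    halts_with g q (prod_encode (x, prod_encode (n, y))) z \<Longrightarrow>
    halts_with g (Prec p q) (prod_encode (x, Suc n)) z"
| Mu: "halts_with g p (prod_encode (x, n)) 0 \<Longrightarrow>
    (\<And>m. m < n \<Longrightarrow> \<exists>y. halts_with g p (prod_encode (x, m)) (Suc y)) \<Longrightarrow>
    halts_with g (Mu p) x n"

inductive_cases halts_with_elims:
  "halts_with g Zero x z"
  "halts_with g Succ x z"
  "halts_with g First x z"
  "halts_with g Second x z"
  "halts_with g Oracle x z"
  "halts_with g (Fork p q) x z"
  "halts_with g (Comp p q) x z"
  "halts_with g (Prec p q) x z"
  "halts_with g (Mu p) x z"

lemma halts_with_deterministic: "halts_with g p x y \<Longrightarrow> halts_with g p x z \<Longrightarrow> y = z"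
proof (induction arbitrary: z rule: halts_with.induct)
  case (Mu p x n)
  from Mu.prems have a: "halts_with g p (prod_encode (x, z)) 0"
    and b: "\<And>m. m < z \<Longrightarrow> \<exists>y. halts_with g p (prod_encode (x, m)) (Suc y)"
    by (auto elim: halts_with_elims)
  have "\<not> n < z"
    using b Mu.IH(1) by blast
  moreover have "\<not> z < n"
    using a Mu.IH(2) by blast
  ultimately show ?case
    by simp
next
  case (Fork p x y q w)
  from Fork.prems show ?case
    by (rule halts_with_elims) (simp add: Fork.IH)
next
  case (Comp q x y p w)
  from Comp.prems show ?case
    by (rule halts_with_elims) (metis Comp.IH)
next
  case (Prec_0 p x y q)
  from Prec_0.prems show ?case
    by (rule halts_with_elims) (auto dest: Prec_0.IH)
next
  case (Prec_Suc p q x n y w)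
  from Prec_Suc.prems show ?case
    by (rule halts_with_elims) (auto dest: Prec_Suc.IH)
qed (erule halts_with_elims; simp)+

definition turing_le :: "(nat \<Rightarrow> nat) \<Rightarrow> (nat \<Rightarrow> nat) \<Rightarrow> bool"  (infix "\<le>\<^sub>T" 50) where
  "f \<le>\<^sub>T g \<longleftrightarrow> (\<exists>p. \<forall>x. halts_with g p x (f x))"

definition computable :: "(nat \<Rightarrow> nat) \<Rightarrow> bool" where
  "computable f \<longleftrightarrow> f \<le>\<^sub>T (\<lambda>_. 0)"

text \<open>Finite strings are coded by \<^const>\<open>list_encode\<close>.\<close>

definition computable_strings :: "nat list set \<Rightarrow> bool" where
  "computable_strings S \<longleftrightarrow> computable (\<lambda>n. if list_decode n \<in> S then 1 else 0)"


section \<open>Turing degrees\<close>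

definition turing_equiv :: "((nat \<Rightarrow> nat) \<times> (nat \<Rightarrow> nat)) set" where
  "turing_equiv = {(f, g). f \<le>\<^sub>T g \<and> g \<le>\<^sub>T f}"

definition turing_degrees :: "(nat \<Rightarrow> nat) set set" where
  "turing_degrees = UNIV // turing_equiv"

definition degree_computes :: "(nat \<Rightarrow> nat) set \<Rightarrow> (nat \<Rightarrow> nat) \<Rightarrow> bool" where
  "degree_computes d f \<longleftrightarrow> (\<exists>g\<in>d. f \<le>\<^sub>T g)"

text \<open>
  Turing equivalence is an equivalence relation, so \<^const>\<open>turing_degrees\<close> is a genuine quotient.
  Transitivity replaces oracle queries by calls of a program that answers them.
\<close>

primrec subst_oracle :: "prog \<Rightarrow> prog \<Rightarrow> prog" where
  "subst_oracle r Zero = Zero"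
| "subst_oracle r Succ = Succ"
| "subst_oracle r First = First"
| "subst_oracle r Second = Second"
| "subst_oracle r Oracle = r"
| "subst_oracle r (Fork p q) = Fork (subst_oracle r p) (subst_oracle r q)"
| "subst_oracle r (Comp p q) = Comp (subst_oracle r p) (subst_oracle r q)"
| "subst_oracle r (Prec p q) = Prec (subst_oracle r p) (subst_oracle r q)"
| "subst_oracle r (Mu p) = Mu (subst_oracle r p)"

lemma halts_with_subst_oracle:
  assumes "halts_with g p x y" and "\<And>x. halts_with h r x (g x)"
  shows "halts_with h (subst_oracle r p) x y"
  using assms(1)
proof (induction rule: halts_with.induct)
  case (Mu p x n)
  then show ?case
    by (auto intro!: halts_with.Mu)
qed (auto intro: halts_with.intros assms(2))

lemma turing_le_refl: "f \<le>\<^sub>T f"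
  unfolding turing_le_def using halts_with.Oracle by blast

lemma turing_le_trans: "f \<le>\<^sub>T g \<Longrightarrow> g \<le>\<^sub>T h \<Longrightarrow> f \<le>\<^sub>T h"
  unfolding turing_le_def using halts_with_subst_oracle by blast

lemma equiv_turing_equiv: "equiv UNIV turing_equiv"
proof (rule equivI)
  show "refl turing_equiv"
    by (simp add: refl_on_def turing_equiv_def turing_le_refl)
  show "sym turing_equiv"
    by (simp add: sym_def turing_equiv_def)
  show "trans turing_equiv"
    unfolding trans_def turing_equiv_def using turing_le_trans by blast
qed simp


section \<open>Trees\<close>

definition is_tree :: "nat list set \<Rightarrow> bool" where
  "is_tree T \<longleftrightarrow> (\<forall>s t. s @ t \<in> T \<longrightarrow> s \<in> T)"

definition immediate_succs :: "nat list set \<Rightarrow> nat list \<Rightarrow> nat list set" where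
  "immediate_succs T s = {t \<in> T. \<exists>i. t = s @ [i]}"

text \<open>Finiteness is explicit because \<^const>\<open>card\<close> is 0 on infinite sets.\<close>

definition k_branching_tree :: "nat \<Rightarrow> nat list set \<Rightarrow> bool" where
  "k_branching_tree k T \<longleftrightarrow> is_tree T \<and>
     (\<forall>s\<in>T. finite (immediate_succs T s) \<and>
       (card (immediate_succs T s) = 1 \<or> card (immediate_succs T s) = k))"

definition k_tree :: "nat \<Rightarrow> nat list set \<Rightarrow> bool" where
  "k_tree k T \<longleftrightarrow> is_tree T \<and>
     (\<forall>s\<in>T. finite (immediate_succs T s) \<and>
       1 \<le> card (immediate_succs T s) \<and> card (immediate_succs T s) \<le> k)"

definition is_path :: "(nat \<Rightarrow> nat) \<Rightarrow> nat list set \<Rightarrow> bool" where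
  "is_path f T \<longleftrightarrow> (\<forall>n. map f [0..<n] \<in> T)"


section \<open>Surviving functions and degrees\<close>

definition globally_tree_surviving :: "(nat \<Rightarrow> nat) \<Rightarrow> bool" where
  "globally_tree_surviving g \<longleftrightarrow>
     (\<forall>k T. k_tree k T \<and> computable_strings T \<longrightarrow> \<not> is_path g T)"

definition two_surviving :: "(nat \<Rightarrow> nat) \<Rightarrow> bool" where
  "two_surviving f \<longleftrightarrow> (\<forall>n. f n < 3) \<and>
     (\<forall>T. T \<subseteq> lists {..<3} \<and> k_branching_tree 2 T \<and> computable_strings T \<longrightarrow> \<not> is_path f T)"

definition globally_tree_surviving_degree :: "(nat \<Rightarrow> nat) set \<Rightarrow> bool" where
  "globally_tree_surviving_degree d \<longleftrightarrow> (\<exists>g. degree_computes d g \<and> globally_tree_surviving g)"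

definition two_surviving_degree :: "(nat \<Rightarrow> nat) set \<Rightarrow> bool" where
  "two_surviving_degree d \<longleftrightarrow> (\<exists>f. degree_computes d f \<and> two_surviving f)"

end

theory Submission
  imports Defs "HOL-Library.Sublist" "HOL-Library.Countable"
begin

text \<open>
  The function \<open>A\<close> is built by forcing with computably enumerated sets of strings, all extending the
  first one, in which every string has, for every \<open>N\<close>, extensions passing through \<open>N\<close> immediate
  successors of a single node. Such a set contains a string outside any given \<open>k\<close>-tree, since
  \<open>k + 1\<close> successors of a single node cannot all lie on the tree.

  Let \<open>p\<close> be a program. If restricting to the extensions of some string makes \<open>p\<close> diverge
  somewhere, makes it take a value \<open>\<ge> 3\<close>, or makes all its values independent of the oracle, then
  that restriction settles \<open>p\<close>; in the last case the function computed from \<open>A\<close> is computable.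
  Otherwise every string has splitting extensions. Then from sufficiently many strings one can
  choose \<open>N\<close> and extend them such that the values of \<open>p\<close> along them are pairwise incompatible and
  no node separates three of them: given a splitting pair, half of the other strings are
  incompatible with one member of it, half of these leave it in the same direction in \<open>3^\<omega>\<close>, and
  one continues with those. Searching computably for such families level by level, with larger and
  larger \<open>N\<close>, gives a smaller condition whose values under \<open>p\<close> form a computable 2-branching tree.
\<close>

section \<open>Closure properties of computable functions\<close>

abbreviation fst' :: "nat \<Rightarrow> nat" where "fst' z \<equiv> fst (prod_decode z)"
abbreviation snd' :: "nat \<Rightarrow> nat" where "snd' z \<equiv> snd (prod_decode z)"

lemma computableI: "(\<And>x. halts_with (\<lambda>_. 0) p x (f x)) \<Longrightarrow> computable f"
  unfolding computable_def turing_le_def by blast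

lemma computableE:
  assumes "computable f"
  obtains p where "\<And>x. halts_with (\<lambda>_. 0) p x (f x)"
  using assms unfolding computable_def turing_le_def by blast

lemma halts_with_First: "halts_with g First z (fst' z)"
  using halts_with.First[of g "fst' z" "snd' z"] by simp

lemma halts_with_Second: "halts_with g Second z (snd' z)"
  using halts_with.Second[of g "fst' z" "snd' z"] by simp

named_theorems comp_intros

lemma computable_id [comp_intros]: "computable (\<lambda>x. x)"
proof (rule computableI)
  show "halts_with (\<lambda>_. 0) (Fork First Second) x x" for x
    using halts_with.Fork[OF halts_with_First halts_with_Second, of "\<lambda>_. 0" x] by simp
qed

lemma computable_comp:
  assumes "computable f" "computable g"
  shows "computable (\<lambda>x. f (g x))"
proof -
  obtain p q where "\<And>x. halts_with (\<lambda>_. 0) p x (f x)" "\<And>x. halts_with (\<lambda>_. 0) q x (g x)"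
    using assms computableE by metis
  then show ?thesis
    by (intro computableI[of "Comp p q"]) (blast intro: halts_with.Comp)
qed

lemma computable_const [comp_intros]: "computable (\<lambda>_. k)"
proof (induction k)
  case 0
  show ?case by (rule computableI[of Zero]) (rule halts_with.Zero)
next
  case (Suc k)
  have "computable Suc" by (rule computableI[of Succ]) (rule halts_with.Succ)
  from computable_comp[OF this Suc] show ?case .
qed

lemma computable_Suc [comp_intros]: "computable f \<Longrightarrow> computable (\<lambda>x. Suc (f x))"
  by (rule computable_comp[of Suc]) (auto intro: computableI[of Succ] halts_with.Succ)

lemma computable_fst [comp_intros]: "computable f \<Longrightarrow> computable (\<lambda>x. fst' (f x))"
  by (rule computable_comp[of fst']) (auto intro: computableI[of First] halts_with_First)

lemma computable_snd [comp_intros]: "computable f \<Longrightarrow> computable (\<lambda>x. snd' (f x))"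
  by (rule computable_comp[of snd']) (auto intro: computableI[of Second] halts_with_Second)

lemma computable_pair [comp_intros]:
  assumes "computable f" "computable g"
  shows "computable (\<lambda>x. prod_encode (f x, g x))"
proof -
  obtain p q where "\<And>x. halts_with (\<lambda>_. 0) p x (f x)" "\<And>x. halts_with (\<lambda>_. 0) q x (g x)"
    using assms computableE by metis
  then show ?thesis
    by (intro computableI[of "Fork p q"]) (blast intro: halts_with.Fork)
qed

text \<open>Programs are unary, so several arguments are read off nested pairs. In
  \<open>computable3\<close> the nesting is the layout in which \<open>Prec\<close> hands parameter,
  counter and previous value to its step program.\<close>

definition computable2 :: "(nat \<Rightarrow> nat \<Rightarrow> nat) \<Rightarrow> bool" where
  "computable2 f \<longleftrightarrow> computable (\<lambda>z. f (fst' z) (snd' z))"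

definition computable3 :: "(nat \<Rightarrow> nat \<Rightarrow> nat \<Rightarrow> nat) \<Rightarrow> bool" where
  "computable3 f \<longleftrightarrow> computable (\<lambda>z. f (fst' z) (fst' (snd' z)) (snd' (snd' z)))"

lemma computable2_app:
  "computable2 f \<Longrightarrow> computable g \<Longrightarrow> computable h \<Longrightarrow> computable (\<lambda>x. f (g x) (h x))"
  unfolding computable2_def
  using computable_comp[of "\<lambda>z. f (fst' z) (snd' z)" "\<lambda>x. prod_encode (g x, h x)"] computable_pair
  by simp

text \<open>\<open>Prec\<close> runs the recursion with \<open>x\<close> as parameter, so both the
  base and the step may depend on \<open>x\<close>. The bound \<open>g x\<close> is then supplied as
  the second component of the input.\<close>

lemma computable_rec [comp_intros]:
  assumes "computable g" "computable f" "computable3 h"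
  shows "computable (\<lambda>x. rec_nat (f x) (h x) (g x))"
proof -
  obtain p where p: "\<And>x. halts_with (\<lambda>_. 0) p x (f x)"
    using assms(2) by (rule computableE) blast
  obtain q where q: "\<And>z. halts_with (\<lambda>_. 0) q z (h (fst' z) (fst' (snd' z)) (snd' (snd' z)))"
    using assms(3)[unfolded computable3_def] by (rule computableE) blast
  have run: "halts_with (\<lambda>_. 0) (Prec p q) (prod_encode (x, n)) (rec_nat (f x) (h x) n)" for x n
  proof (induction n)
    case 0
    show ?case using halts_with.Prec_0[OF p] by simp
  next
    case (Suc n)
    show ?case
      using halts_with.Prec_Suc[OF Suc] q[of "prod_encode (x, prod_encode (n, rec_nat (f x) (h x) n))"]
      by simp
  qed
  have "halts_with (\<lambda>_. 0) (Prec p q) z (rec_nat (f (fst' z)) (h (fst' z)) (snd' z))" for z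
    using run[of "fst' z" "snd' z"] by simp
  then have "computable2 (\<lambda>x n. rec_nat (f x) (h x) n)"
    unfolding computable2_def by (rule computableI)
  from computable2_app[OF this computable_id assms(1)] show ?thesis .
qed

section \<open>Decidable predicates, arithmetic and bounded quantifiers\<close>

definition decidable :: "(nat \<Rightarrow> bool) \<Rightarrow> bool" where
  "decidable P \<longleftrightarrow> computable (\<lambda>x. if P x then 1 else 0)"

definition decidable2 :: "(nat \<Rightarrow> nat \<Rightarrow> bool) \<Rightarrow> bool" where
  "decidable2 P \<longleftrightarrow> decidable (\<lambda>z. P (fst' z) (snd' z))"

lemma decidable2_app:
  "decidable2 P \<Longrightarrow> computable g \<Longrightarrow> computable h \<Longrightarrow> decidable (\<lambda>x. P (g x) (h x))"
  unfolding decidable2_def decidable_def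
  using computable2_app[of "\<lambda>x y. if P x y then 1 else 0" g h] by (simp add: computable2_def)

text \<open>A conditional is a recursion run zero times or once: the base is the else branch, and
  the single step discards it for the then branch.\<close>

lemma computable_if [comp_intros]:
  assumes "decidable P" "computable f" "computable g"
  shows "computable (\<lambda>x. if P x then f x else g x)"
proof -
  have "computable (\<lambda>z. f (fst' z))"
    using assms(2) by (rule computable_comp) (intro comp_intros)
  then have "computable (\<lambda>x. rec_nat (g x) (\<lambda>_ _. f x) (if P x then 1 else 0))"
    using assms by (intro comp_intros) (auto simp: computable3_def decidable_def)
  also have "(\<lambda>x. rec_nat (g x) (\<lambda>_ _. f x) (if P x then 1 else 0)) = (\<lambda>x. if P x then f x else g x)"
    by (auto simp: fun_eq_iff)
  finally show ?thesis .
qed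

lemma computable_add [comp_intros]:
  assumes "computable f" "computable g"
  shows "computable (\<lambda>x. f x + g x)"
proof -
  have *: "rec_nat a (\<lambda>_ y. Suc y) n = a + n" for a n
    by (induction n) auto
  have "computable (\<lambda>x. rec_nat (f x) (\<lambda>_ y. Suc y) (g x))"
    using assms by (auto intro!: comp_intros simp: computable3_def)
  then show ?thesis by (simp only: *)
qed

lemma computable_mult [comp_intros]:
  assumes "computable f" "computable g"
  shows "computable (\<lambda>x. f x * g x)"
proof -
  have *: "rec_nat 0 (\<lambda>_ y. a + y) n = a * n" for a n :: nat
    by (induction n) auto
  have "computable (\<lambda>z. f (fst' z))"
    using assms(1) by (rule computable_comp) (intro comp_intros)
  then have "computable (\<lambda>x. rec_nat 0 (\<lambda>_ y. f x + y) (g x))"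
    using assms by (auto intro!: comp_intros simp: computable3_def)
  then show ?thesis by (simp only: *)
qed

lemma computable_diff [comp_intros]:
  assumes "computable f" "computable g"
  shows "computable (\<lambda>x. f x - g x)"
proof -
  have p: "rec_nat 0 (\<lambda>n _. n) n = n - 1" for n :: nat
    by (induction n) auto
  have *: "rec_nat a (\<lambda>_ y. y - 1) n = a - n" for a n :: nat
    by (induction n) auto
  have pred: "computable (\<lambda>x. h x - 1)" if "computable h" for h
  proof -
    have "computable (\<lambda>x. rec_nat 0 (\<lambda>n _. n) (h x))"
      using that by (auto intro!: comp_intros simp: computable3_def)
    then show ?thesis by (simp only: p)
  qed
  have "computable (\<lambda>x. rec_nat (f x) (\<lambda>_ y. y - 1) (g x))"
    unfolding computable3_def
    using assms by (intro comp_intros) (simp_all only: computable3_def, intro pred comp_intros)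
  then show ?thesis by (simp only: *)
qed

lemma computable_fact [comp_intros]:
  assumes "computable f"
  shows "computable (\<lambda>x. fact (f x))"
proof -
  have *: "rec_nat 1 (\<lambda>n y. Suc n * y) n = fact n" for n :: nat
    by (induction n) auto
  have "computable (\<lambda>x. rec_nat 1 (\<lambda>n y. Suc n * y) (f x))"
    using assms by (intro comp_intros) (simp_all only: computable3_def, intro comp_intros)
  then show ?thesis by (simp only: *)
qed

lemma decidable_not [comp_intros]:
  assumes "decidable P"
  shows "decidable (\<lambda>x. \<not> P x)"
proof -
  have "computable (\<lambda>x. if P x then 0 else 1)"
    using assms by (intro comp_intros)
  moreover have "(\<lambda>x. if P x then 0 else 1) = (\<lambda>x. if \<not> P x then 1 else (0::nat))"
    by auto
  ultimately show ?thesis unfolding decidable_def by metis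
qed

lemma decidable_conj [comp_intros]:
  assumes "decidable P" "decidable Q"
  shows "decidable (\<lambda>x. P x \<and> Q x)"
proof -
  have "computable (\<lambda>x. if P x then (if Q x then 1 else 0) else 0)"
    using assms by (intro comp_intros)
  moreover have "(\<lambda>x. if P x then (if Q x then 1 else 0) else 0) = (\<lambda>x. if P x \<and> Q x then 1 else (0::nat))"
    by auto
  ultimately show ?thesis unfolding decidable_def by metis
qed

lemma decidable_disj [comp_intros]:
  "decidable P \<Longrightarrow> decidable Q \<Longrightarrow> decidable (\<lambda>x. P x \<or> Q x)"
  using decidable_not[OF decidable_conj[OF decidable_not decidable_not], of P Q] by simp

lemma decidable_imp [comp_intros]:
  "decidable P \<Longrightarrow> decidable Q \<Longrightarrow> decidable (\<lambda>x. P x \<longrightarrow> Q x)"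
  using decidable_disj[OF decidable_not, of P Q] by (simp only: imp_conv_disj)

lemma decidable_less [comp_intros]:
  assumes "computable f" "computable g"
  shows "decidable (\<lambda>x. f x < g x)"
proof -
  have "rec_nat 0 (\<lambda>_ _. 1) n = (if 0 < n then 1 else (0::nat))" for n :: nat
    by (induction n) auto
  then have "(if f x < g x then 1 else 0) = rec_nat 0 (\<lambda>_ _. 1::nat) (g x - f x)" for x
    by simp
  moreover have "computable (\<lambda>x. rec_nat 0 (\<lambda>_ _. 1) (g x - f x))"
    using assms by (intro comp_intros) (simp_all only: computable3_def, intro comp_intros)
  ultimately show ?thesis unfolding decidable_def by simp
qed

lemma decidable_le [comp_intros]:
  "computable f \<Longrightarrow> computable g \<Longrightarrow> decidable (\<lambda>x. f x \<le> g x)"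
  using decidable_not[OF decidable_less, of g f] by (simp add: not_less)

lemma decidable_eq [comp_intros]:
  "computable f \<Longrightarrow> computable g \<Longrightarrow> decidable (\<lambda>x. f x = g x)"
  using decidable_conj[OF decidable_le decidable_le, of f g g f] by (simp add: order_eq_iff)

text \<open>A recursion up to the bound keeps the value 1 until the first counterexample and stays
  at 0 from there on.\<close>

lemma decidable_all [comp_intros]:
  assumes "computable b" "decidable2 P"
  shows "decidable (\<lambda>x. \<forall>y<b x. P x y)"
proof -
  have *: "rec_nat 1 (\<lambda>n y. if P x n then y else 0) n = (if \<forall>y<n. P x y then 1 else (0::nat))" for x n
    by (induction n) (auto simp: less_Suc_eq)
  have "decidable (\<lambda>z. P (fst' z) (fst' (snd' z)))"
    using assms(2) by (rule decidable2_app) (intro comp_intros)+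
  then have "computable (\<lambda>x. rec_nat 1 (\<lambda>n y. if P x n then y else 0) (b x))"
    using assms(1) by (intro comp_intros) (simp_all only: computable3_def, intro comp_intros)
  then show ?thesis by (simp only: * decidable_def)
qed

lemma decidable_ex [comp_intros]:
  assumes "computable b" "decidable2 P"
  shows "decidable (\<lambda>x. \<exists>y<b x. P x y)"
proof -
  have "decidable (\<lambda>x. \<not> (\<forall>y<b x. \<not> P x y))"
    using assms(2) by (intro comp_intros assms(1)) (simp add: decidable2_def decidable_not)
  then show ?thesis by simp
qed

section \<open>Unbounded search\<close>

lemma halts_with_Least:
  assumes p: "\<And>z. halts_with g p z (if P (fst' z) (snd' z) then 0 else 1)" and ex: "\<exists>y. P x y"
  shows "halts_with g (Mu p) x (LEAST y. P x y)"
proof (rule halts_with.Mu)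
  show "halts_with g p (prod_encode (x, LEAST y. P x y)) 0"
    using p[of "prod_encode (x, LEAST y. P x y)"] LeastI_ex[OF ex] by simp
  fix m assume "m < (LEAST y. P x y)"
  then have "\<not> P x m" by (rule not_less_Least)
  then show "\<exists>y. halts_with g p (prod_encode (x, m)) (Suc y)"
    using p[of "prod_encode (x, m)"] by auto
qed

text \<open>\<open>Mu\<close> looks for a zero, so truth is coded by 0 here, the opposite of the
  convention in \<open>decidable\<close>.\<close>

lemma decidable2_program:
  assumes "decidable2 P"
  obtains p where "\<And>z. halts_with (\<lambda>_. 0) p z (if P (fst' z) (snd' z) then 0 else 1)"
proof -
  have "computable (\<lambda>z. if P (fst' z) (snd' z) then 0 else 1)"
    using assms unfolding decidable2_def by (intro comp_intros)
  then show ?thesis by (rule computableE) (rule that)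
qed

lemma computable_Least [comp_intros]:
  assumes "decidable2 P" "\<And>x. \<exists>y. P x y"
  shows "computable (\<lambda>x. LEAST y. P x y)"
proof -
  obtain p where p: "\<And>z. halts_with (\<lambda>_. 0) p z (if P (fst' z) (snd' z) then 0 else 1)"
    using assms(1) by (rule decidable2_program) blast
  show ?thesis by (rule computableI, rule halts_with_Least[OF p assms(2)])
qed

text \<open>The search is known to end only at the pairs \<open>(n, f n)\<close> that are actually
  reached, so its step need not be a total function and \<open>computable_rec\<close> cannot be
  applied. The recursion is therefore run as a program along the values of \<open>f\<close>.\<close>

lemma computable_iterated_Least:
  assumes P: "decidable2 (\<lambda>z y. P (fst' z) (snd' z) y)"
    and ex: "\<And>n. \<exists>y. P n (f n) y" and step: "\<And>n. f (Suc n) = (LEAST y. P n (f n) y)"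
  shows "computable f"
proof -
  obtain p where p: "\<And>z. halts_with (\<lambda>_. 0) p z
      (if P (fst' (fst' z)) (snd' (fst' z)) (snd' z) then 0 else 1)"
    using P by (rule decidable2_program) blast
  obtain q where q: "\<And>x. halts_with (\<lambda>_. 0) q x (f 0)"
    using computable_const by (rule computableE) blast
  \<comment> \<open>The recursion has no real parameter: \<open>Comp (Mu p) Second\<close> drops
    \<open>x\<close>, and at the end the input itself is inserted as a dummy.\<close>
  have run: "halts_with (\<lambda>_. 0) (Prec q (Comp (Mu p) Second)) (prod_encode (x, n)) (f n)" for x n
  proof (induction n)
    case 0
    show ?case using halts_with.Prec_0[OF q] by simp
  next
    case (Suc n)
    have "halts_with (\<lambda>_. 0) (Mu p) (prod_encode (n, f n)) (f (Suc n))"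
      using halts_with_Least[of "\<lambda>_. 0" p "\<lambda>z y. P (fst' z) (snd' z) y" "prod_encode (n, f n)"]
        p ex step by simp
    from halts_with.Prec_Suc[OF Suc halts_with.Comp[OF halts_with.Second this]] show ?case .
  qed
  have "halts_with (\<lambda>_. 0) (Prec q (Comp (Mu p) Second)) z (f (snd' z))" for z
    using run[of "fst' z" "snd' z"] by simp
  then have "computable (\<lambda>z. f (snd' z))" by (rule computableI)
  from computable_comp[OF this, of "\<lambda>x. prod_encode (x, x)"] show ?thesis
    by (simp add: computable_pair computable_id)
qed

text \<open>The quotient is found by search, as the least \<open>q\<close> whose next multiple
  exceeds the dividend. A divisor of the form \<open>Suc\<close> excludes division by zero.\<close>

lemma computable_div_Suc [comp_intros]:
  assumes "computable f" "computable g"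
  shows "computable (\<lambda>x. f x div Suc (g x))"
proof -
  have *: "(LEAST q. f x < Suc q * Suc (g x)) = f x div Suc (g x)" for x
  proof (rule Least_equality)
    show "f x < Suc (f x div Suc (g x)) * Suc (g x)"
      using dividend_less_div_times[of "Suc (g x)" "f x"] by (simp add: add.commute)
    show "f x div Suc (g x) \<le> q" if "f x < Suc q * Suc (g x)" for q
      using that less_mult_imp_div_less[of "f x" "Suc q" "Suc (g x)"] by simp
  qed
  have "computable (\<lambda>z. f (fst' z))" "computable (\<lambda>z. g (fst' z))"
    using computable_comp[OF assms(1) computable_fst[OF computable_id]]
      computable_comp[OF assms(2) computable_fst[OF computable_id]] .
  then have "computable (\<lambda>x. LEAST q. f x < Suc q * Suc (g x))"
  proof (intro comp_intros)
    show "\<exists>q. f x < Suc q * Suc (g x)" for x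
      by (rule exI[of _ "f x"]) simp
  qed (simp only: decidable2_def, intro comp_intros)
  then show ?thesis by (simp only: *)
qed

subsection \<open>Coded strings\<close>

text \<open>\<open>list_encode\<close> sends the empty list to 0 and a nonempty list to the
  successor of a pair of head and coded tail, so subtracting 1 and taking the second component
  removes the head.\<close>

definition tl_code :: "nat \<Rightarrow> nat \<Rightarrow> nat" where
  "tl_code c k = rec_nat c (\<lambda>_ y. snd' (y - 1)) k"

definition len :: "nat \<Rightarrow> nat" where
  "len c = length (list_decode c)"

definition entry :: "nat \<Rightarrow> nat \<Rightarrow> nat" where
  "entry c k = fst' (tl_code c k - 1)"

lemma list_decode_tl_code: "k \<le> len c \<Longrightarrow> list_decode (tl_code c k) = drop k (list_decode c)"
proof (induction k)
  case 0
  show ?case by (simp add: tl_code_def)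
next
  case (Suc k)
  then have IH: "list_decode (tl_code c k) = drop k (list_decode c)" and k: "k < length (list_decode c)"
    by (auto simp: len_def)
  then have "list_decode (tl_code c k) \<noteq> []" by simp
  then obtain m where m: "tl_code c k = Suc m"
    by (cases "tl_code c k") auto
  have "tl_code c (Suc k) = snd' m"
    using m by (simp add: tl_code_def)
  moreover have "list_decode (Suc m) = fst' m # list_decode (snd' m)"
    by (simp split: prod.split)
  ultimately show ?case
    using IH m k by (metis drop_Suc tl_drop list.sel(3))
qed

lemma entry_nth: "k < len c \<Longrightarrow> entry c k = list_decode c ! k"
proof -
  assume k: "k < len c"
  then have IH: "list_decode (tl_code c k) = drop k (list_decode c)"
    by (intro list_decode_tl_code) simp
  have "list_decode (tl_code c k) \<noteq> []" using k IH by (simp add: len_def)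
  then obtain m where m: "tl_code c k = Suc m"
    by (cases "tl_code c k") auto
  have "list_decode (Suc m) = fst' m # list_decode (snd' m)"
    by (simp split: prod.split)
  then show ?thesis
    using IH m k by (metis entry_def diff_Suc_1 hd_drop_conv_nth len_def list.sel(1))
qed

text \<open>Only the empty list has code 0, and it is reached after exactly as many removals as
  there are entries. This turns the length into a search.\<close>

lemma len_eq_Least: "len c = (LEAST k. tl_code c k = 0)"
proof (rule Least_equality[symmetric])
  have "list_decode (tl_code c (len c)) = []"
    by (simp add: list_decode_tl_code) (simp add: len_def)
  then show "tl_code c (len c) = 0"
    by (metis list_encode.simps(1) list_decode_inverse)
  fix k assume "tl_code c k = 0"
  then show "len c \<le> k"
    using list_decode_tl_code[of k c] by (cases "k \<le> len c") (auto simp: len_def)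
qed

lemma computable_tl_code [comp_intros]:
  assumes "computable f" "computable g"
  shows "computable (\<lambda>x. tl_code (f x) (g x))"
  unfolding tl_code_def
  using assms by (intro comp_intros) (simp_all only: computable3_def, intro comp_intros)

lemma computable_entry [comp_intros]:
  "computable f \<Longrightarrow> computable g \<Longrightarrow> computable (\<lambda>x. entry (f x) (g x))"
  unfolding entry_def by (intro comp_intros)

lemma computable_len [comp_intros]:
  assumes "computable f"
  shows "computable (\<lambda>x. len (f x))"
proof -
  have "computable (\<lambda>c. LEAST k. tl_code c k = 0)"
  proof (intro comp_intros)
    show "\<exists>k. tl_code c k = 0" for c
    proof -
      have "list_decode (tl_code c (len c)) = []"
        by (simp add: list_decode_tl_code) (simp add: len_def)
      then show ?thesis
        by (metis list_encode.simps(1) list_decode_inverse)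
    qed
  qed (simp only: decidable2_def, intro comp_intros)
  then have "computable len" by (simp add: len_eq_Least[abs_def])
  from computable_comp[OF this assms] show ?thesis .
qed

section \<open>Evaluation with a finite oracle\<close>

text \<open>The result 0 means that no value has been found, \<open>Suc v\<close> that the value is \<open>v\<close>. The length of
  the oracle also bounds the searches, so this is a total function.\<close>

primrec ev :: "prog \<Rightarrow> nat list \<Rightarrow> nat \<Rightarrow> nat" where
  "ev Zero \<sigma> x = 1"
| "ev Succ \<sigma> x = Suc (Suc x)"
| "ev First \<sigma> x = Suc (fst' x)"
| "ev Second \<sigma> x = Suc (snd' x)"
| "ev Oracle \<sigma> x = (if x < length \<sigma> then Suc (\<sigma> ! x) else 0)"
| "ev (Fork p q) \<sigma> x = (if ev p \<sigma> x = 0 \<or> ev q \<sigma> x = 0 then 0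
     else Suc (prod_encode (ev p \<sigma> x - 1, ev q \<sigma> x - 1)))"
| "ev (Comp p q) \<sigma> x = (if ev q \<sigma> x = 0 then 0 else ev p \<sigma> (ev q \<sigma> x - 1))"
| "ev (Prec p q) \<sigma> x = rec_nat (ev p \<sigma> (fst' x))
     (\<lambda>n y. if y = 0 then 0 else ev q \<sigma> (prod_encode (fst' x, prod_encode (n, y - 1)))) (snd' x)"
| "ev (Mu p) \<sigma> x = (let n = LEAST n. length \<sigma> \<le> n \<or> ev p \<sigma> (prod_encode (x, n)) \<le> 1
     in if n < length \<sigma> \<and> ev p \<sigma> (prod_encode (x, n)) = 1 then Suc n else 0)"

text \<open>Because results are shifted by one, 1 stands for the value 0 that \<open>Mu\<close>
  looks for, and results above 1 for positive values that let the search go on.\<close>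

lemma ev_Mu_eq_SucI:
  assumes "n < length \<sigma>" "ev p \<sigma> (prod_encode (x, n)) = 1"
    and "\<And>m. m < n \<Longrightarrow> 1 < ev p \<sigma> (prod_encode (x, m))"
  shows "ev (Mu p) \<sigma> x = Suc n"
proof -
  have "(LEAST n. length \<sigma> \<le> n \<or> ev p \<sigma> (prod_encode (x, n)) \<le> 1) = n"
  proof (rule Least_equality)
    show "n \<le> m" if "length \<sigma> \<le> m \<or> ev p \<sigma> (prod_encode (x, m)) \<le> 1" for m
      using that assms(1) assms(3)[of m] by linarith
  qed (use assms in simp)
  then show ?thesis using assms by (simp add: Let_def)
qed

lemma ev_MuE:
  assumes "ev (Mu p) \<sigma> x \<noteq> 0"
  obtains n where "ev (Mu p) \<sigma> x = Suc n" "n < length \<sigma>" "ev p \<sigma> (prod_encode (x, n)) = 1"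
    "\<And>m. m < n \<Longrightarrow> 1 < ev p \<sigma> (prod_encode (x, m))"
proof -
  define n where "n = (LEAST n. length \<sigma> \<le> n \<or> ev p \<sigma> (prod_encode (x, n)) \<le> 1)"
  have n: "ev (Mu p) \<sigma> x = Suc n" "n < length \<sigma>" "ev p \<sigma> (prod_encode (x, n)) = 1"
    using assms unfolding ev.simps Let_def n_def[symmetric] by (metis One_nat_def)+
  have "1 < ev p \<sigma> (prod_encode (x, m))" if "m < n" for m
    using not_less_Least[OF that[unfolded n_def]] by simp
  with n that show ?thesis by blast
qed

text \<open>A computation that has produced a value asks only about entries of
  \<open>\<sigma>\<close>, and a search that has succeeded is unaffected by a larger bound.\<close>

lemma ev_mono: "prefix \<sigma> \<tau> \<Longrightarrow> ev p \<sigma> x \<noteq> 0 \<Longrightarrow> ev p \<tau> x = ev p \<sigma> x"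
proof (induction p arbitrary: x)
  case Oracle
  then show ?case by (auto simp: prefix_def nth_append split: if_splits)
next
  case (Fork p q)
  then show ?case by (metis ev.simps(6))
next
  case (Comp p q)
  then show ?case by (metis ev.simps(7))
next
  case (Prec p q)
  \<comment> \<open>The recursion depth is made a variable so that the claim can be proved by
    induction on it.\<close>
  define R where "R = (\<lambda>\<sigma> n. rec_nat (ev p \<sigma> (fst' x))
     (\<lambda>n y. if y = 0 then 0 else ev q \<sigma> (prod_encode (fst' x, prod_encode (n, y - 1)))) n)"
  have "R \<sigma> n \<noteq> 0 \<Longrightarrow> R \<tau> n = R \<sigma> n" for n
  proof (induction n)
    case 0
    then show ?case using Prec.IH(1) Prec.prems(1) by (simp add: R_def)
  next
    case (Suc n)
    have step: "R \<upsilon> (Suc n) = (if R \<upsilon> n = 0 then 0 else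
        ev q \<upsilon> (prod_encode (fst' x, prod_encode (n, R \<upsilon> n - 1))))" for \<upsilon>
      by (simp add: R_def)
    from Suc.prems have "R \<sigma> n \<noteq> 0" by (auto simp: step split: if_splits)
    with Suc have "R \<tau> n = R \<sigma> n" by blast
    with Suc.prems show ?case using Prec.IH(2) Prec.prems(1) by (simp add: step split: if_splits)
  qed
  then show ?case using Prec.prems(2) by (simp add: R_def)
next
  case (Mu p)
  from Mu.prems(2) obtain n where n: "ev (Mu p) \<sigma> x = Suc n" "n < length \<sigma>"
    "ev p \<sigma> (prod_encode (x, n)) = 1" "\<And>m. m < n \<Longrightarrow> 1 < ev p \<sigma> (prod_encode (x, m))"
    by (rule ev_MuE) blast
  have "ev (Mu p) \<tau> x = Suc n"
  proof (rule ev_Mu_eq_SucI)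
    show "n < length \<tau>" using n(2) Mu.prems(1) prefix_length_le by fastforce
    show "ev p \<tau> (prod_encode (x, n)) = 1" using Mu.IH[OF Mu.prems(1)] n(3) by simp
    show "1 < ev p \<tau> (prod_encode (x, m))" if "m < n" for m
      using Mu.IH[OF Mu.prems(1), of "prod_encode (x, m)"] n(4)[OF that] by simp
  qed
  then show ?case using n(1) by simp
qed simp_all

text \<open>Induction over the halting derivation. Each rule combines finitely many facts that hold
  for all long oracles; for \<open>Mu\<close> these are the results at all \<open>m \<le> n\<close>,
  and the oracle must also be longer than \<open>n\<close> to admit the search.\<close>

lemma ev_eventually:
  "halts_with A p x y \<Longrightarrow> eventually (\<lambda>n. ev p (map A [0..<n]) x = Suc y) at_top"
proof (induction rule: halts_with.induct)
  case (Oracle x)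
  show ?case using eventually_gt_at_top[of x] by eventually_elim simp
next
  case (Fork p x y q z)
  from Fork.IH show ?case by eventually_elim simp
next
  case (Comp q x y p z)
  from Comp.IH show ?case by eventually_elim simp
next
  case (Prec_0 p x y q)
  from Prec_0.IH show ?case by eventually_elim simp
next
  case (Prec_Suc p q x n y z)
  from Prec_Suc.IH show ?case by eventually_elim (simp cong: if_cong)
next
  case (Mu p x n)
  have "eventually (\<lambda>k. 1 < ev p (map A [0..<k]) (prod_encode (x, m))) at_top" if m: "m < n" for m
  proof -
    from Mu.IH(2)[OF m] obtain y where
      "eventually (\<lambda>k. ev p (map A [0..<k]) (prod_encode (x, m)) = Suc (Suc y)) at_top"
      by blast
    then show ?thesis by eventually_elim simp
  qed
  then have "eventually (\<lambda>k. \<forall>m\<in>{..<n}. 1 < ev p (map A [0..<k]) (prod_encode (x, m))) at_top"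
    by (intro eventually_ball_finite) auto
  with Mu.IH(1) eventually_gt_at_top[of n] show ?case
    by eventually_elim (auto intro!: ev_Mu_eq_SucI simp del: ev.simps)
qed simp_all

text \<open>The program is fixed, so the evaluator can be assembled by induction over its syntax,
  with the coded oracle and the input as its two arguments.\<close>

lemma computable_ev_aux: "computable2 (\<lambda>c x. ev p (list_decode c) x)"
proof (induction p)
  case Oracle
  have "(if x < length (list_decode c) then Suc (list_decode c ! x) else 0) =
      (if x < len c then Suc (entry c x) else 0)" for c x
    by (simp add: entry_nth) (simp add: len_def)
  then show ?case unfolding computable2_def ev.simps by (simp only:) (intro comp_intros)
next
  case (Fork p q)
  note [comp_intros] = Fork.IH[THEN computable2_app]
  show ?case unfolding computable2_def ev.simps by (intro comp_intros)
next
  case (Comp p q)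
  note [comp_intros] = Comp.IH[THEN computable2_app]
  show ?case unfolding computable2_def ev.simps by (intro comp_intros)
next
  case (Prec p q)
  note [comp_intros] = Prec.IH[THEN computable2_app]
  show ?case unfolding computable2_def ev.simps
    by (intro comp_intros) (simp only: computable3_def, intro comp_intros)
next
  case (Mu p)
  note [comp_intros] = Mu.IH[THEN computable2_app]
  show ?case unfolding computable2_def ev.simps Let_def len_def[symmetric]
  proof (intro comp_intros)
    \<comment> \<open>Unfolding \<open>Let\<close> leaves three copies of the search, and each must
      be shown to end; the length of the oracle is always a solution.\<close>
    show "\<exists>n. len (fst' z) \<le> n \<or> ev p (list_decode (fst' z)) (prod_encode (snd' z, n)) \<le> 1" for z
      by blast
    show "\<exists>n. len (fst' z) \<le> n \<or> ev p (list_decode (fst' z)) (prod_encode (snd' z, n)) \<le> 1" for z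
      by blast
    show "\<exists>n. len (fst' z) \<le> n \<or> ev p (list_decode (fst' z)) (prod_encode (snd' z, n)) \<le> 1" for z
      by blast
  qed (simp_all only: decidable2_def, (intro comp_intros)+)
qed (simp_all only: ev.simps computable2_def, (intro comp_intros)+)

lemma computable_ev [comp_intros]:
  "computable f \<Longrightarrow> computable g \<Longrightarrow> computable (\<lambda>x. ev p (list_decode (f x)) (g x))"
  using computable2_app[OF computable_ev_aux] .

section \<open>Splitting\<close>

definition separated :: "'i set \<Rightarrow> nat \<Rightarrow> ('i \<Rightarrow> nat \<Rightarrow> nat) \<Rightarrow> bool" where
  "separated I l w \<longleftrightarrow> (\<forall>i\<in>I. \<forall>j\<in>I. i \<noteq> j \<longrightarrow> (\<exists>x<l. w i x \<noteq> w j x))"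

text \<open>Equivalently, in the tree of initial segments of the \<open>w i\<close>, every node of
  length below \<open>l\<close> has at most two immediate successors.\<close>

definition binary :: "'i set \<Rightarrow> nat \<Rightarrow> ('i \<Rightarrow> nat \<Rightarrow> nat) \<Rightarrow> bool" where
  "binary I l w \<longleftrightarrow> (\<forall>i\<in>I. \<forall>j\<in>I. \<forall>k\<in>I. \<forall>x<l. (\<forall>y<x. w i y = w j y \<and> w j y = w k y) \<longrightarrow>
     w i x = w j x \<or> w i x = w k x \<or> w j x = w k x)"

lemma binaryD:
  "binary I l w \<Longrightarrow> i \<in> I \<Longrightarrow> j \<in> I \<Longrightarrow> k \<in> I \<Longrightarrow> x < l \<Longrightarrow>
    \<forall>y<x. w i y = w j y \<and> w j y = w k y \<Longrightarrow> w i x = w j x \<or> w i x = w k x \<or> w j x = w k x"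
  unfolding binary_def by blast

text \<open>Extensions of the strings in a spread family pass through different immediate successors of
  one node.\<close>

definition spread :: "nat \<Rightarrow> nat \<Rightarrow> (nat \<Rightarrow> nat list) \<Rightarrow> bool" where
  "spread N r b \<longleftrightarrow> (\<forall>i<N. r < length (b i)) \<and>
     (\<forall>i<N. \<forall>j<N. i \<noteq> j \<longrightarrow> (\<forall>x<r. b i ! x = b j ! x) \<and> b i ! r \<noteq> b j ! r)"

definition fan :: "nat list set \<Rightarrow> bool" where
  "fan X \<longleftrightarrow> (\<forall>\<sigma>\<in>X. \<forall>N. \<exists>b r. (\<forall>i<N. b i \<in> X \<and> prefix \<sigma> (b i)) \<and> spread N r b)"

lemma nth_prefix: "prefix \<sigma> \<tau> \<Longrightarrow> x < length \<sigma> \<Longrightarrow> \<tau> ! x = \<sigma> ! x"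
  by (auto simp: prefix_def nth_append)

lemma spread_extend:
  assumes "spread N r b" "\<And>i. i < N \<Longrightarrow> prefix (b i) (b' i)"
  shows "spread N r b'"
proof -
  have len: "r < length (b i)" if "i < N" for i
    using assms(1) that by (simp add: spread_def)
  have eq: "b' i ! x = b i ! x" if "i < N" "x \<le> r" for i x
    using nth_prefix[OF assms(2)[OF that(1)]] len[OF that(1)] that(2) by simp
  show ?thesis
    unfolding spread_def
  proof (intro conjI allI impI)
    show "r < length (b' i)" if "i < N" for i
      using prefix_length_le[OF assms(2)[OF that]] len[OF that] by simp
    fix i j assume ij: "i < N" "j < N" "i \<noteq> j"
    then have b: "\<forall>x<r. b i ! x = b j ! x" "b i ! r \<noteq> b j ! r"
      using assms(1) unfolding spread_def by blast+
    show "b' i ! x = b' j ! x" if "x < r" for x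
      using b(1) eq ij that by simp
    show "b' i ! r \<noteq> b' j ! r"
      using b(2) eq ij by simp
  qed
qed

lemma spread_reindex:
  assumes "spread M r b" "h ` {..<N} \<subseteq> {..<M}" "inj_on h {..<N}"
  shows "spread N r (\<lambda>i. b (h i))"
proof -
  have "h i < M" "i \<noteq> j \<Longrightarrow> h i \<noteq> h j" if "i < N" "j < N" for i j
    using assms(2,3) that by (auto simp: inj_on_def)
  then show ?thesis
    using assms(1) unfolding spread_def by metis
qed

text \<open>\<open>V\<close> abstracts \<open>ev p\<close>: 0 means undecided, so the bound 3 leaves
  1, 2, 3 as codes of the values 0, 1, 2.\<close>

locale splitting =
  fixes X :: "nat list set" and V :: "nat list \<Rightarrow> nat \<Rightarrow> nat"
  assumes mono: "prefix \<sigma> \<tau> \<Longrightarrow> V \<sigma> x \<noteq> 0 \<Longrightarrow> V \<tau> x = V \<sigma> x"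
    and total: "\<sigma> \<in> X \<Longrightarrow> \<exists>\<tau>\<in>X. prefix \<sigma> \<tau> \<and> V \<tau> x \<noteq> 0"
    and bound: "\<sigma> \<in> X \<Longrightarrow> V \<sigma> x \<le> 3"
    and split: "\<sigma> \<in> X \<Longrightarrow> \<exists>\<tau>\<in>X. \<exists>\<upsilon>\<in>X. \<exists>x. prefix \<sigma> \<tau> \<and> prefix \<sigma> \<upsilon> \<and>
      V \<tau> x \<noteq> 0 \<and> V \<upsilon> x \<noteq> 0 \<and> V \<tau> x \<noteq> V \<upsilon> x"
    and fan: "fan X"
begin

definition defd :: "nat \<Rightarrow> nat list \<Rightarrow> bool" where
  "defd l \<tau> \<longleftrightarrow> (\<forall>x<l. V \<tau> x \<noteq> 0)"

definition good :: "'i set \<Rightarrow> nat \<Rightarrow> ('i \<Rightarrow> nat list) \<Rightarrow> bool" where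
  "good I l b \<longleftrightarrow> (\<forall>i\<in>I. b i \<in> X \<and> defd l (b i)) \<and>
     separated I l (\<lambda>i. V (b i)) \<and> binary I l (\<lambda>i. V (b i))"

section \<open>Extending and enlarging good families\<close>

lemma defd_V_eq: "defd l \<sigma> \<Longrightarrow> prefix \<sigma> \<tau> \<Longrightarrow> x < l \<Longrightarrow> V \<tau> x = V \<sigma> x"
  using mono by (simp add: defd_def)

lemma ex_defd: "\<sigma> \<in> X \<Longrightarrow> \<exists>\<tau>\<in>X. prefix \<sigma> \<tau> \<and> defd l \<tau>"
proof (induction l)
  case 0
  then show ?case by (auto simp: defd_def)
next
  case (Suc l)
  then obtain \<tau> where \<tau>: "\<tau> \<in> X" "prefix \<sigma> \<tau>" "defd l \<tau>" by blast
  obtain \<upsilon> where \<upsilon>: "\<upsilon> \<in> X" "prefix \<tau> \<upsilon>" "V \<upsilon> l \<noteq> 0" using total[OF \<tau>(1)] by blast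
  then have "defd (Suc l) \<upsilon>"
    using \<tau>(3) defd_V_eq[OF \<tau>(3) \<upsilon>(2)] by (auto simp: defd_def less_Suc_eq)
  then show ?case using \<upsilon> \<tau>(2) prefix_order.trans by blast
qed

text \<open>Distinct members already differ below \<open>l\<close>, so three of them can agree up to
  \<open>x\<close> only if \<open>x < l\<close>. No threefold branching can arise at the new
  heights, and below \<open>l\<close> nothing changes.\<close>

lemma good_extend:
  assumes g: "good I l b" and l: "l \<le> l'"
  shows "\<exists>b'. (\<forall>i\<in>I. prefix (b i) (b' i)) \<and> good I l' b'"
proof -
  have "\<forall>i\<in>I. \<exists>\<tau>\<in>X. prefix (b i) \<tau> \<and> defd l' \<tau>"
    using g ex_defd by (simp add: good_def)
  then obtain b' where b': "\<forall>i\<in>I. b' i \<in> X \<and> prefix (b i) (b' i) \<and> defd l' (b' i)" by metis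
  have eq: "V (b' i) x = V (b i) x" if "i \<in> I" "x < l" for i x
    using defd_V_eq[of l "b i" "b' i" x] that g b' by (simp add: good_def)
  have sep: "\<exists>x<l. V (b' i) x \<noteq> V (b' j) x" if "i \<in> I" "j \<in> I" "i \<noteq> j" for i j
    using g that eq unfolding good_def separated_def by metis
  have "binary I l' (\<lambda>i. V (b' i))"
    unfolding binary_def
  proof (intro ballI allI impI)
    fix i j k x assume i: "i \<in> I" "j \<in> I" "k \<in> I" "x < l'"
      and agree: "\<forall>y<x. V (b' i) y = V (b' j) y \<and> V (b' j) y = V (b' k) y"
    show "V (b' i) x = V (b' j) x \<or> V (b' i) x = V (b' k) x \<or> V (b' j) x = V (b' k) x"
    proof (cases "i = j")
      case False
      then obtain y where y: "y < l" "V (b' i) y \<noteq> V (b' j) y" using sep i by blast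
      with agree have "x < l" by (meson leI order_less_le_trans)
      moreover from this have "\<forall>y<x. V (b i) y = V (b j) y \<and> V (b j) y = V (b k) y"
        using agree eq i by (metis order_less_trans)
      ultimately have "V (b i) x = V (b j) x \<or> V (b i) x = V (b k) x \<or> V (b j) x = V (b k) x"
        using g i(1-3) unfolding good_def binary_def by blast
      then show ?thesis using eq i \<open>x < l\<close> by simp
    qed simp
  qed
  moreover have "separated I l' (\<lambda>i. V (b' i))"
    unfolding separated_def using sep l by (meson order_less_le_trans)
  ultimately show ?thesis using b' unfolding good_def by blast
qed

text \<open>A new member can differ from all others in such a way that they all leave it in the same
  direction, where the three values are ordered cyclically. Then no node splits into three.\<close>

lemma good_insert:
  assumes g: "good J l b" and w: "w \<in> X" "defd l w" and i: "i0 \<notin> J"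
    and d: "\<And>j. j \<in> J \<Longrightarrow> d j < l \<and> V (b j) (d j) \<noteq> V w (d j) \<and> (\<forall>y<d j. V (b j) y = V w y)"
    and same: "\<And>j k. j \<in> J \<Longrightarrow> k \<in> J \<Longrightarrow> d j = d k \<Longrightarrow> V (b j) (d j) = V (b k) (d k)"
  shows "good (insert i0 J) l (b(i0 := w))"
proof -
  define W where "W i = V ((b(i0 := w)) i)" for i
  have W: "W i0 = V w" "\<And>j. j \<in> J \<Longrightarrow> W j = V (b j)"
    using i by (auto simp: W_def)
  \<comment> \<open>Both \<open>j\<close> and \<open>k\<close> leave the new member exactly at
    \<open>x\<close>, so their points of first difference coincide and \<open>same\<close>
    applies.\<close>
  have key: "W j x = W k x" if "j \<in> J" "k \<in> J" "W j x \<noteq> W i0 x" "W k x \<noteq> W i0 x"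
    "\<forall>y<x. W j y = W i0 y \<and> W k y = W i0 y" for j k x
  proof -
    have "d j = x" "d k = x"
      using d[OF that(1)] d[OF that(2)] that W by (metis linorder_neqE_nat)+
    then show ?thesis using same[OF that(1,2)] W that by simp
  qed
  have "separated (insert i0 J) l W"
    unfolding separated_def
  proof (intro ballI impI)
    fix i j assume ij: "i \<in> insert i0 J" "j \<in> insert i0 J" "i \<noteq> j"
    consider "i \<in> J" "j \<in> J" | "i = i0" "j \<in> J" | "i \<in> J" "j = i0"
      using ij by blast
    then show "\<exists>x<l. W i x \<noteq> W j x"
    proof cases
      case 1
      then show ?thesis using g ij W unfolding good_def separated_def by simp
    next
      case 2
      then show ?thesis using d[of j] W by metis
    next
      case 3
      then show ?thesis using d[of i] W by metis
    qed
  qed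
  moreover have "binary (insert i0 J) l W"
    unfolding binary_def
  proof (intro ballI allI impI)
    fix i j k x assume ijk: "i \<in> insert i0 J" "j \<in> insert i0 J" "k \<in> insert i0 J" and x: "x < l"
      and agree: "\<forall>y<x. W i y = W j y \<and> W j y = W k y"
    show "W i x = W j x \<or> W i x = W k x \<or> W j x = W k x"
    proof (cases "i = j \<or> j = k \<or> i = k")
      case False
      then consider "i \<in> J" "j \<in> J" "k \<in> J" | "i = i0" "j \<in> J" "k \<in> J"
        | "i \<in> J" "j = i0" "k \<in> J" | "i \<in> J" "j \<in> J" "k = i0"
        using ijk by blast
      then show ?thesis
      proof cases
        case 1
        then show ?thesis using g agree x W unfolding good_def binary_def by simp
      next
        case 2
        then show ?thesis using key[of j k x] agree by metis
      next
        case 3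
        then show ?thesis using key[of i k x] agree by metis
      next
        case 4
        then show ?thesis using key[of i j x] agree by metis
      qed
    qed auto
  qed
  ultimately show ?thesis
    using g w unfolding good_def W_def by auto
qed

section \<open>Pigeonhole selection of good subfamilies\<close>

lemma ex_half:
  assumes "finite A" "A \<subseteq> B \<union> C" "2 * M \<le> card A"
  shows "M \<le> card (A \<inter> B) \<or> M \<le> card (A \<inter> C)"
proof -
  have "A = (A \<inter> B) \<union> (A \<inter> C)" using assms(2) by blast
  then have "card A \<le> card (A \<inter> B) + card (A \<inter> C)" by (metis card_Un_le)
  then show ?thesis using assms(3) by linarith
qed

text \<open>Arbitrary finite index sets are allowed, rather than only initial segments, so that the
  property can be applied to the subset left over by a pigeonhole step.\<close>

definition ample :: "nat \<Rightarrow> nat \<Rightarrow> bool" where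
  "ample N M \<longleftrightarrow> (\<forall>(I :: nat set) \<sigma>. finite I \<longrightarrow> M \<le> card I \<longrightarrow> (\<forall>i\<in>I. \<sigma> i \<in> X) \<longrightarrow>
    (\<exists>J\<subseteq>I. card J = N \<and> (\<exists>l b. (\<forall>j\<in>J. prefix (\<sigma> j) (b j)) \<and> good J l b)))"

lemma ampleD:
  fixes I :: "nat set"
  assumes "ample N M" "finite I" "M \<le> card I" "\<forall>i\<in>I. \<sigma> i \<in> X"
  obtains J l b where "J \<subseteq> I" "card J = N" "\<forall>j\<in>J. prefix (\<sigma> j) (b j)" "good J l b"
  using assms(1)[unfolded ample_def, rule_format, OF assms(2,3), of \<sigma>] assms(4) by blast

text \<open>From \<open>4 * M + 1\<close> strings one is set aside to become the new member, and two
  halvings leave \<open>M\<close> others, to which the induction hypothesis applies.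
  \<open>good_insert\<close> then adds the new member.\<close>

lemma ex_ample: "\<exists>M. ample N M"
proof (induction N)
  case 0
  have "good {} 0 \<sigma>" for \<sigma> :: "nat \<Rightarrow> nat list"
    by (simp add: good_def separated_def binary_def)
  then have "ample 0 0"
    unfolding ample_def by (intro allI impI exI[of _ "{}"]) auto
  then show ?case by blast
next
  case (Suc N)
  then obtain M where IH: "ample N M" by blast
  have "\<exists>J\<subseteq>I. card J = Suc N \<and> (\<exists>l b. (\<forall>j\<in>J. prefix (\<sigma> j) (b j)) \<and> good J l b)"
    if fin: "finite I" and card: "4 * M + 1 \<le> card I" and \<sigma>: "\<forall>i\<in>I. \<sigma> i \<in> X" for I :: "nat set" and \<sigma>
  proof -
    from card obtain i0 where i0: "i0 \<in> I" by fastforce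
    define I' where "I' = I - {i0}"
    have I': "finite I'" "2 * (2 * M) \<le> card I'" using fin card i0 by (auto simp: I'_def)
    obtain u0 v0 x where uv0: "u0 \<in> X" "v0 \<in> X" "prefix (\<sigma> i0) u0" "prefix (\<sigma> i0) v0"
      "V u0 x \<noteq> 0" "V v0 x \<noteq> 0" "V u0 x \<noteq> V v0 x"
      using split \<sigma> i0 by blast
    define l where "l = Suc x"
    obtain u where u: "u \<in> X" "prefix u0 u" "defd l u" using ex_defd[OF uv0(1)] by blast
    obtain v where v: "v \<in> X" "prefix v0 v" "defd l v" using ex_defd[OF uv0(2)] by blast
    have uv: "V u x \<noteq> V v x" using mono[OF u(2)] mono[OF v(2)] uv0 by simp
    have "\<forall>i\<in>I. \<exists>\<tau>\<in>X. prefix (\<sigma> i) \<tau> \<and> defd l \<tau>" using \<sigma> ex_defd by blast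
    then obtain \<sigma>' where \<sigma>': "\<forall>i\<in>I. \<sigma>' i \<in> X \<and> prefix (\<sigma> i) (\<sigma>' i) \<and> defd l (\<sigma>' i)" by metis
    define differs where "differs w = {i. \<exists>y<l. V (\<sigma>' i) y \<noteq> V w y}" for w
    \<comment> \<open>\<open>u\<close> and \<open>v\<close> have different values at
      \<open>x\<close>, so no string can agree with both of them there.\<close>
    have "I' \<subseteq> differs u \<union> differs v"
    proof
      fix i show "i \<in> differs u \<union> differs v"
        using uv by (cases "V (\<sigma>' i) x = V u x") (auto simp: differs_def l_def)
    qed
    from ex_half[OF I'(1) this I'(2)]
    obtain w where w: "w \<in> X" "prefix (\<sigma> i0) w" "defd l w" "2 * M \<le> card (I' \<inter> differs w)"
      using u v uv0 prefix_order.trans by metis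
    define d where "d i = (LEAST y. V (\<sigma>' i) y \<noteq> V w y)" for i
    have d: "d i < l \<and> V (\<sigma>' i) (d i) \<noteq> V w (d i) \<and> (\<forall>y<d i. V (\<sigma>' i) y = V w y)"
      if "i \<in> differs w" for i
    proof -
      from that obtain y where y: "y < l" "V (\<sigma>' i) y \<noteq> V w y" by (auto simp: differs_def)
      have "d i \<le> y" "V (\<sigma>' i) (d i) \<noteq> V w (d i)"
        unfolding d_def using y(2) by (rule Least_le, rule LeastI)
      moreover have "V (\<sigma>' i) z = V w z" if "z < d i" for z
        using not_less_Least[OF that[unfolded d_def]] by blast
      ultimately show ?thesis using y(1) by simp
    qed
    \<comment> \<open>\<open>A\<close> collects the strings that leave \<open>w\<close> towards the
      cyclic successor of its value in 1, 2, 3. A string that differs from \<open>w\<close> but is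
      outside \<open>A\<close> takes the one remaining value.\<close>
    define A where "A = {i. V (\<sigma>' i) (d i) = (if V w (d i) = 3 then 1 else V w (d i) + 1)}"
    have "I' \<inter> differs w \<subseteq> A \<union> - A" by blast
    from ex_half[OF _ this w(4)] I'(1)
    obtain B where B: "B = A \<or> B = - A" "M \<le> card ((I' \<inter> differs w) \<inter> B)" by blast
    define C where "C = (I' \<inter> differs w) \<inter> B"
    have C: "C \<subseteq> I" "i0 \<notin> C" "finite C" "M \<le> card C" "C \<subseteq> differs w" "C \<subseteq> B"
      using I'(1) B(2) by (auto simp: C_def I'_def)
    have same: "V (\<sigma>' j) (d j) = V (\<sigma>' k) (d k)" if jk: "j \<in> C" "k \<in> C" "d j = d k" for j k
    proof -
      have val: "V (\<sigma>' i) (d i) \<noteq> V w (d i) \<and> V (\<sigma>' i) (d i) \<noteq> 0 \<and> V (\<sigma>' i) (d i) \<le> 3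
          \<and> V w (d i) \<noteq> 0 \<and> V w (d i) \<le> 3" if "i \<in> C" for i
      proof -
        have "i \<in> I" "i \<in> differs w" using that C by auto
        then show ?thesis using d[of i] \<sigma>' w(1,3) bound unfolding defd_def by blast
      qed
      \<comment> \<open>\<open>C\<close> lies entirely in \<open>A\<close> or entirely in its
        complement. With the value of \<open>w\<close> and the point of departure given, this
        determines the value taken there.\<close>
      have "V (\<sigma>' j) (d k) = (if V w (d k) = 3 then 1 else V w (d k) + 1) \<longleftrightarrow>
          V (\<sigma>' k) (d k) = (if V w (d k) = 3 then 1 else V w (d k) + 1)"
        using B(1) C(6) jk by (auto simp: A_def)
      then show ?thesis
        using val[OF jk(1)] val[OF jk(2)] unfolding jk(3) by presburger
    qed
    have "\<forall>i\<in>C. \<sigma>' i \<in> X" using \<sigma>' C(1) by blast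
    from IH C(3,4) this obtain J l1 b where J: "J \<subseteq> C" "card J = N"
      "\<forall>j\<in>J. prefix (\<sigma>' j) (b j)" "good J l1 b" by (rule ampleD)
    \<comment> \<open>Below \<open>l\<close> the chosen strings differ from \<open>w\<close>, and at
      \<open>l1\<close> they form a good family; the maximum preserves both.\<close>
    define l2 where "l2 = max l l1"
    obtain b1 where b1: "\<forall>j\<in>J. prefix (b j) (b1 j)" "good J l2 b1"
      using good_extend[OF J(4), of l2] by (auto simp: l2_def)
    obtain w2 where w2: "w2 \<in> X" "prefix w w2" "defd l2 w2" using ex_defd[OF w(1)] by blast
    have pre: "prefix (\<sigma>' j) (b1 j)" if "j \<in> J" for j
      using J(3) b1(1) that prefix_order.trans by blast
    have eq: "V (b1 j) y = V (\<sigma>' j) y" if "j \<in> J" "y < l" for j y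
      using defd_V_eq[OF _ pre that(2)] \<sigma>' C(1) J(1) that by blast
    have eqw: "V w2 y = V w y" if "y < l" for y
      using defd_V_eq[OF w(3) w2(2) that] .
    have "good (insert i0 J) l2 (b1(i0 := w2))"
    proof (rule good_insert[OF b1(2) w2(1,3)])
      show "i0 \<notin> J" using J(1) C(2) by blast
      fix j assume j: "j \<in> J"
      then have dj: "d j < l \<and> V (\<sigma>' j) (d j) \<noteq> V w (d j) \<and> (\<forall>y<d j. V (\<sigma>' j) y = V w y)"
        using d J(1) C(5) by blast
      then show "d j < l2 \<and> V (b1 j) (d j) \<noteq> V w2 (d j) \<and> (\<forall>y<d j. V (b1 j) y = V w2 y)"
        using eq[OF j] eqw by (auto simp: l2_def)
      fix k assume k: "k \<in> J" "d j = d k"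
      then show "V (b1 j) (d j) = V (b1 k) (d k)"
        using same[of j k] eq[OF j] eq[OF k(1)] dj j J(1) by auto
    qed
    moreover have "\<forall>j\<in>insert i0 J. prefix (\<sigma> j) ((b1(i0 := w2)) j)"
    proof
      fix j assume j: "j \<in> insert i0 J"
      show "prefix (\<sigma> j) ((b1(i0 := w2)) j)"
      proof (cases "j = i0")
        case True
        then show ?thesis using w(2) w2(2) prefix_order.trans by auto
      next
        case False
        then have "j \<in> J" "j \<in> I" using j J(1) C(1) by auto
        then show ?thesis using False pre[of j] \<sigma>' prefix_order.trans by fastforce
      qed
    qed
    moreover have "insert i0 J \<subseteq> I" using J(1) C(1) i0 by blast
    moreover have "card (insert i0 J) = Suc N"
      using J(1,2) C(2,3) by (metis card_insert_disjoint finite_subset subsetD)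
    ultimately show ?thesis by blast
  qed
  then have "ample (Suc N) (4 * M + 1)" unfolding ample_def by blast
  then show ?case ..
qed

text \<open>A fan of \<open>M\<close> strings is taken first and then thinned out to
  \<open>N\<close> of them by ampleness. Both thinning and extending preserve the spread.\<close>

lemma ex_good_fan:
  assumes "\<sigma> \<in> X"
  shows "\<exists>b r l. (\<forall>i<N. prefix \<sigma> (b i)) \<and> spread N r b \<and> good {..<N} l b"
proof -
  obtain M where M: "ample N M" using ex_ample by blast
  obtain b0 r where b0: "\<forall>i<M. b0 i \<in> X \<and> prefix \<sigma> (b0 i)" "spread M r b0"
    using fan assms unfolding fan_def by blast
  obtain J l b where J: "J \<subseteq> {..<M}" "card J = N" "\<forall>j\<in>J. prefix (b0 j) (b j)" "good J l b"
    using b0(1) by (auto intro: ampleD[OF M, of "{..<M}" b0])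
  have "finite J" using J(1) finite_subset by blast
  then obtain h where "bij_betw h {0..<card J} J" using ex_bij_betw_nat_finite by blast
  then have h: "bij_betw h {..<N} J" using J(2) by (simp add: atLeast0LessThan)
  then have hJ: "\<And>i. i < N \<Longrightarrow> h i \<in> J" and inj: "inj_on h {..<N}"
    by (auto simp: bij_betw_def)
  have "spread N r (\<lambda>i. b0 (h i))"
    by (rule spread_reindex[OF b0(2) _ inj]) (use hJ J(1) in blast)
  then have "spread N r (\<lambda>i. b (h i))"
    by (rule spread_extend) (use J(3) hJ in blast)
  moreover have "\<forall>i<N. prefix \<sigma> (b (h i))"
    using b0(1) J(1,3) hJ prefix_order.trans by (metis lessThan_iff subsetD)
  moreover have "good {..<N} l (\<lambda>i. b (h i))"
    unfolding good_def separated_def binary_def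
  proof (intro conjI ballI allI impI; (elim lessThan_iff[THEN iffD1, elim_format])?)
    fix i j assume ij: "i < N" "j < N" "i \<noteq> j"
    then have "h i \<noteq> h j" using inj by (auto simp: inj_on_def)
    then show "\<exists>x<l. V (b (h i)) x \<noteq> V (b (h j)) x"
      using J(4) hJ ij unfolding good_def separated_def by blast
  next
    fix i j k x assume "i < N" "j < N" "k < N" "x < l"
      "\<forall>y<x. V (b (h i)) y = V (b (h j)) y \<and> V (b (h j)) y = V (b (h k)) y"
    then show "V (b (h i)) x = V (b (h j)) x \<or> V (b (h i)) x = V (b (h k)) x \<or> V (b (h j)) x = V (b (h k)) x"
      using J(4) hJ unfolding good_def binary_def by blast
  qed (use J(4) hJ in \<open>auto simp: good_def\<close>)
  ultimately show ?thesis by (intro exI[of _ "\<lambda>i. b (h i)"]) blast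
qed

text \<open>Member \<open>k\<close> is child number \<open>k mod N\<close> of parent
  \<open>k div N\<close>. Three members with the same parent are handled by the good fan above it.
  Otherwise two of them already differ below \<open>l\<close>, so a node they all pass through lies
  below \<open>l\<close>, where the parents form a good family.\<close>

lemma ex_next_level:
  assumes a: "good {..<m} l a" and N: "0 < N"
  shows "\<exists>l' rs a'. l < l' \<and> good {..<m * N} l' a' \<and> (\<forall>k<m * N. prefix (a (k div N)) (a' k)) \<and>
    (\<forall>i<m. spread N (rs i) (\<lambda>j. a' (i * N + j)))"
proof -
  have "\<forall>i\<in>{..<m}. \<exists>b r l. (\<forall>j<N. prefix (a i) (b j)) \<and> spread N r b \<and> good {..<N} l b"
    using ex_good_fan a unfolding good_def by blast
  then obtain b rs ls where b: "\<And>i j. i < m \<Longrightarrow> j < N \<Longrightarrow> prefix (a i) (b i j)"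
    "\<And>i. i < m \<Longrightarrow> spread N (rs i) (b i)" "\<And>i. i < m \<Longrightarrow> good {..<N} (ls i) (b i)"
    by (metis lessThan_iff)
  \<comment> \<open>The sum bounds every \<open>ls i\<close>, so all fans can be extended to this
    common depth; \<open>Suc\<close> makes the depth grow strictly.\<close>
  define l' where "l' = Suc (l + (\<Sum>i<m. ls i))"
  have "ls i \<le> l'" if "i < m" for i
    using that member_le_sum[of i "{..<m}" ls] by (auto simp: l'_def)
  then have "\<forall>i\<in>{..<m}. \<exists>b'. (\<forall>j\<in>{..<N}. prefix (b i j) (b' j)) \<and> good {..<N} l' b'"
    using good_extend[OF b(3)] by blast
  then obtain b' where b': "\<And>i j. i < m \<Longrightarrow> j < N \<Longrightarrow> prefix (b i j) (b' i j)"
    "\<And>i. i < m \<Longrightarrow> good {..<N} l' (b' i)"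
    by (metis lessThan_iff)
  define a' where "a' k = b' (k div N) (k mod N)" for k
  have a'_eq: "a' (i * N + j) = b' i j" if "j < N" for i j
    using that N by (simp add: a'_def)
  have dm: "k div N < m" "k mod N < N" if "k < m * N" for k
    using that N by (auto simp: less_mult_imp_div_less)
  have pre: "prefix (a (k div N)) (a' k)" if "k < m * N" for k
    unfolding a'_def using b(1)[OF dm] b'(1)[OF dm] that prefix_order.trans by blast
  have eq: "V (a' k) x = V (a (k div N)) x" if "k < m * N" "x < l" for k x
    using defd_V_eq[OF _ pre that(2)] a dm that by (auto simp: good_def)
  have sep: "\<exists>x<l. V (a' k) x \<noteq> V (a' k') x"
    if "k < m * N" "k' < m * N" "k div N \<noteq> k' div N" for k k'
    using a dm that eq unfolding good_def separated_def by (metis lessThan_iff)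
  have l: "l < l'" by (simp add: l'_def)
  have "separated {..<m * N} l' (\<lambda>k. V (a' k))"
    unfolding separated_def
  proof (intro ballI impI)
    fix k k' assume kk: "k \<in> {..<m * N}" "k' \<in> {..<m * N}" "k \<noteq> k'"
    show "\<exists>x<l'. V (a' k) x \<noteq> V (a' k') x"
    proof (cases "k div N = k' div N")
      case True
      with kk have "k mod N \<noteq> k' mod N" by (metis div_mult_mod_eq)
      then show ?thesis
        using b'(2)[of "k div N"] dm[of k] dm[of k'] kk True
        unfolding good_def separated_def a'_def by simp
    next
      case False
      then show ?thesis using sep[of k k'] kk l order_less_trans by (metis lessThan_iff)
    qed
  qed
  moreover have "binary {..<m * N} l' (\<lambda>k. V (a' k))"
    unfolding binary_def
  proof (intro ballI allI impI)
    fix i j k x assume ijk: "i \<in> {..<m * N}" "j \<in> {..<m * N}" "k \<in> {..<m * N}" and x: "x < l'"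
      and agree: "\<forall>y<x. V (a' i) y = V (a' j) y \<and> V (a' j) y = V (a' k) y"
    show "V (a' i) x = V (a' j) x \<or> V (a' i) x = V (a' k) x \<or> V (a' j) x = V (a' k) x"
    proof (cases "i div N = j div N \<and> j div N = k div N")
      case True
      then show ?thesis
        using b'(2)[of "i div N"] dm[of i] dm[of j] dm[of k] ijk agree x
        unfolding good_def binary_def a'_def by simp
    next
      case False
      then obtain y where "y < l" "V (a' i) y \<noteq> V (a' j) y \<or> V (a' j) y \<noteq> V (a' k) y"
        using sep[of i j] sep[of j k] ijk by auto
      then have xl: "x < l" using agree by (meson leI order_less_le_trans)
      then have "\<forall>y<x. V (a (i div N)) y = V (a (j div N)) y \<and> V (a (j div N)) y = V (a (k div N)) y"
        using agree eq ijk by (metis lessThan_iff order_less_trans)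
      moreover have "i div N < m" "j div N < m" "k div N < m" using dm ijk by auto
      ultimately have "V (a (i div N)) x = V (a (j div N)) x \<or> V (a (i div N)) x = V (a (k div N)) x \<or>
          V (a (j div N)) x = V (a (k div N)) x"
        using a xl unfolding good_def binary_def by blast
      then show ?thesis using eq[OF _ xl] ijk by auto
    qed
  qed
  moreover have "\<forall>k\<in>{..<m * N}. a' k \<in> X \<and> defd l' (a' k)"
    using b'(2) dm unfolding good_def a'_def by simp
  ultimately have "good {..<m * N} l' a'" by (simp add: good_def)
  moreover have "spread N (rs i) (\<lambda>j. a' (i * N + j))" if i: "i < m" for i
    by (rule spread_extend[OF b(2)[OF i]]) (simp add: a'_eq b'(1)[OF i])
  ultimately show ?thesis using l pre by blast
qed

end

section \<open>Conditions\<close>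

abbreviation str :: "(nat \<Rightarrow> nat) \<Rightarrow> nat \<Rightarrow> nat list" where
  "str e i \<equiv> list_decode (e i)"

abbreviation strs :: "(nat \<Rightarrow> nat) \<Rightarrow> nat list set" where
  "strs e \<equiv> range (str e)"

text \<open>The set of strings is given by a computable enumeration, and string number 0 is its
  stem.\<close>

definition condition :: "(nat \<Rightarrow> nat) \<Rightarrow> bool" where
  "condition e \<longleftrightarrow> computable e \<and> (\<forall>i. prefix (str e 0) (str e i)) \<and> fan (strs e)"

definition initial :: "nat list \<Rightarrow> (nat \<Rightarrow> nat) \<Rightarrow> bool" where
  "initial \<sigma> A \<longleftrightarrow> map A [0..<length \<sigma>] = \<sigma>"

text \<open>A condition need not be closed under initial segments, so the function is asked only to
  have arbitrarily long initial segments in it.\<close>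

definition through :: "(nat \<Rightarrow> nat) \<Rightarrow> (nat \<Rightarrow> nat) \<Rightarrow> bool" where
  "through A e \<longleftrightarrow> (\<forall>n. \<exists>\<sigma>\<in>strs e. n \<le> length \<sigma> \<and> initial \<sigma> A)"

lemma through_mono: "through A e' \<Longrightarrow> strs e' \<subseteq> strs e \<Longrightarrow> through A e"
  unfolding through_def by blast

lemma initial_iff_nth: "initial \<sigma> A \<longleftrightarrow> (\<forall>x<length \<sigma>. \<sigma> ! x = A x)"
  unfolding initial_def list_eq_iff_nth_eq by auto

lemma initial_prefix: "initial \<tau> A \<Longrightarrow> prefix \<sigma> \<tau> \<Longrightarrow> initial \<sigma> A"
  unfolding initial_iff_nth by (metis nth_prefix prefix_length_le order_less_le_trans)

lemma prefix_map_upt: "m \<le> n \<Longrightarrow> prefix (map A [0..<m]) (map A [0..<n])"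
  by (metis le_add_diff_inverse map_append prefixI upt_add_eq_append zero_le)

text \<open>A value found on an initial segment persists on longer ones by \<open>ev_mono\<close>,
  and on sufficiently long ones it is the true value.\<close>

lemma ev_initial:
  assumes "halts_with A p x y" "initial \<sigma> A" "ev p \<sigma> x \<noteq> 0"
  shows "ev p \<sigma> x = Suc y"
proof -
  obtain n where n: "\<forall>m\<ge>n. ev p (map A [0..<m]) x = Suc y"
    using ev_eventually[OF assms(1)] by (auto simp: eventually_at_top_linorder)
  define m where "m = max n (length \<sigma>)"
  have "prefix \<sigma> (map A [0..<m])"
    using prefix_map_upt[of "length \<sigma>" m A] assms(2) by (simp add: m_def initial_def)
  from ev_mono[OF this assms(3)] show ?thesis using n[rule_format, of m] by (simp add: m_def)
qed

lemma ev_initial_long: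
  assumes "halts_with A p x y" "through A e"
  shows "\<exists>\<sigma>\<in>strs e. initial \<sigma> A \<and> n \<le> length \<sigma> \<and> ev p \<sigma> x = Suc y"
proof -
  obtain k where k: "\<forall>m\<ge>k. ev p (map A [0..<m]) x = Suc y"
    using ev_eventually[OF assms(1)] by (auto simp: eventually_at_top_linorder)
  obtain \<sigma> where \<sigma>: "\<sigma> \<in> strs e" "max k n \<le> length \<sigma>" "initial \<sigma> A"
    using assms(2) unfolding through_def by blast
  have "ev p (map A [0..<length \<sigma>]) x = Suc y" using k \<sigma>(2) by simp
  then have "ev p \<sigma> x = Suc y" using \<sigma>(3) by (simp add: initial_def)
  then show ?thesis using \<sigma> by auto
qed

section \<open>Deciding the prefix relation and passing to cones\<close>

lemma prefix_iff_entry: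
  "prefix (list_decode c) (list_decode d) \<longleftrightarrow> len c \<le> len d \<and> (\<forall>x<len c. entry c x = entry d x)"
proof (intro iffI conjI allI impI; (elim conjE)?)
  assume p: "prefix (list_decode c) (list_decode d)"
  show l: "len c \<le> len d" using prefix_length_le[OF p] by (simp add: len_def)
  fix x assume "x < len c"
  then show "entry c x = entry d x"
    using nth_prefix[OF p] l by (simp add: entry_nth) (simp add: len_def)
next
  assume l: "len c \<le> len d" and eq: "\<forall>x<len c. entry c x = entry d x"
  have "list_decode c = take (len c) (list_decode d)"
    by (rule nth_equalityI) (use l eq in \<open>auto simp: len_def entry_nth[symmetric]\<close>)
  then show "prefix (list_decode c) (list_decode d)" by (metis take_is_prefix)
qed

lemma decidable_prefix [comp_intros]:
  assumes "computable f" "computable g"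
  shows "decidable (\<lambda>x. prefix (list_decode (f x)) (list_decode (g x)))"
proof -
  have "computable (\<lambda>z. f (fst' z))" "computable (\<lambda>z. g (fst' z))"
    using computable_comp[OF assms(1) computable_fst[OF computable_id]]
      computable_comp[OF assms(2) computable_fst[OF computable_id]] .
  then show ?thesis
    unfolding prefix_iff_entry
    by (intro comp_intros assms) (simp only: decidable2_def, intro comp_intros)
qed

text \<open>Indices of strings outside the cone are redirected to \<open>e j\<close>, which keeps
  the enumeration total and computable.\<close>

definition cone :: "(nat \<Rightarrow> nat) \<Rightarrow> nat \<Rightarrow> nat \<Rightarrow> nat" where
  "cone e j i = (if prefix (str e j) (str e i) then e i else e j)"

lemma strs_cone: "strs (cone e j) = {\<sigma>\<in>strs e. prefix (str e j) \<sigma>}"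
proof (intro equalityI subsetI)
  fix \<sigma> assume "\<sigma> \<in> strs (cone e j)"
  then show "\<sigma> \<in> {\<sigma>\<in>strs e. prefix (str e j) \<sigma>}"
    by (auto simp: cone_def split: if_splits)
next
  fix \<sigma> assume "\<sigma> \<in> {\<sigma>\<in>strs e. prefix (str e j) \<sigma>}"
  then obtain i where "\<sigma> = str e i" "prefix (str e j) (str e i)" by auto
  then have "\<sigma> = str (cone e j) i" by (simp add: cone_def)
  then show "\<sigma> \<in> strs (cone e j)" by blast
qed

text \<open>If the old stem lies in the cone of \<open>str e j\<close>, it equals
  \<open>str e j\<close>, being a prefix of it; if not, index 0 is redirected there.\<close>

lemma str_cone_0: "condition e \<Longrightarrow> str (cone e j) 0 = str e j"
  unfolding condition_def cone_def using prefix_order.antisym by auto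

lemma condition_cone:
  assumes e: "condition e"
  shows "condition (cone e j)"
proof -
  have "computable e" using e by (simp add: condition_def)
  then have "computable (cone e j)"
    unfolding cone_def by (intro comp_intros)
  moreover have "prefix (str (cone e j) 0) (str (cone e j) i)" for i
    unfolding str_cone_0[OF e] by (simp add: cone_def)
  moreover have "fan (strs (cone e j))"
    unfolding fan_def
  proof (intro ballI allI)
    fix \<sigma> N assume \<sigma>: "\<sigma> \<in> strs (cone e j)"
    then obtain b r where b: "\<forall>i<N. b i \<in> strs e \<and> prefix \<sigma> (b i)" "spread N r b"
      using e unfolding condition_def fan_def strs_cone by blast
    have "\<forall>i<N. b i \<in> strs (cone e j) \<and> prefix \<sigma> (b i)"
      using b(1) \<sigma> unfolding strs_cone by (metis (mono_tags, lifting) mem_Collect_eq prefix_order.trans)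
    then show "\<exists>b r. (\<forall>i<N. b i \<in> strs (cone e j) \<and> prefix \<sigma> (b i)) \<and> spread N r b"
      using b(2) by blast
  qed
  ultimately show ?thesis unfolding condition_def by blast
qed

lemma through_cone:
  assumes "condition e" "through A (cone e j)"
  shows "initial (str e j) A"
proof -
  obtain \<sigma> where "\<sigma> \<in> strs (cone e j)" "initial \<sigma> A"
    using assms(2) unfolding through_def by blast
  then show ?thesis using initial_prefix[of \<sigma> A "str e j"] unfolding strs_cone by blast
qed

lemma strs_cone_subset: "strs (cone e j) \<subseteq> strs e"
  unfolding strs_cone by blast

text \<open>Two spread extensions of the stem differ at \<open>r\<close>, so \<open>r\<close> lies
  beyond the stem but within them.\<close>

lemma ex_longer:
  assumes e: "condition e"
  shows "\<exists>j. length (str e 0) < length (str e j)"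
proof -
  obtain b r where b: "\<forall>i<2. b i \<in> strs e \<and> prefix (str e 0) (b i)" "spread 2 r b"
    using e unfolding condition_def fan_def by blast
  have "length (str e 0) < length (b 0)"
  proof (rule ccontr)
    assume "\<not> length (str e 0) < length (b 0)"
    moreover have "r < length (b 0)" using b(2) by (simp add: spread_def)
    ultimately have "r < length (str e 0)" by simp
    then have "b 0 ! r = b 1 ! r" using b(1) nth_prefix[of "str e 0" "b 0" r] nth_prefix[of "str e 0" "b 1" r] by simp
    then show False using b(2)[unfolded spread_def, THEN conjunct2, rule_format, of 0 1] by simp
  qed
  moreover have "b 0 \<in> strs e" using b(1) by simp
  ultimately show ?thesis by auto
qed

lemma avoid_k_tree:
  assumes e: "condition e" and S: "k_tree k S"
  shows "\<exists>e'. condition e' \<and> strs e' \<subseteq> strs e \<and> (\<forall>A. through A e' \<longrightarrow> \<not> is_path A S)"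
proof -
  have "\<exists>j. str e j \<notin> S"
  proof (rule ccontr)
    assume "\<not> (\<exists>j. str e j \<notin> S)"
    then have sub: "strs e \<subseteq> S" by auto
    obtain b r where b: "\<forall>i<Suc k. b i \<in> strs e \<and> prefix (str e 0) (b i)" "spread (Suc k) r b"
      using e unfolding condition_def fan_def by blast
    have closed: "\<sigma> \<in> S" if "prefix \<sigma> \<tau>" "\<tau> \<in> S" for \<sigma> \<tau>
      using S that unfolding k_tree_def is_tree_def prefix_def by blast
    have r: "r < length (b i)" if "i < Suc k" for i
      using b(2) that by (simp add: spread_def)
    have same: "take r (b i) = take r (b 0)" if i: "i < Suc k" for i
    proof (rule nth_equalityI)
      fix x assume "x < length (take r (b i))"
      then show "take r (b i) ! x = take r (b 0) ! x"
        using b(2) i unfolding spread_def by (cases "i = 0") auto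
    qed (use r[OF i] r[of 0] in simp)
    let ?T = "immediate_succs S (take r (b 0))"
    have "take (Suc r) (b i) \<in> ?T" if i: "i < Suc k" for i
    proof -
      have "take (Suc r) (b i) = take r (b 0) @ [b i ! r]"
        using r[OF i] same[OF i] by (simp add: take_Suc_conv_app_nth)
      moreover have "take (Suc r) (b i) \<in> S"
        by (rule closed[OF take_is_prefix]) (use b(1) i sub in auto)
      ultimately show ?thesis unfolding immediate_succs_def by auto
    qed
    then have "(\<lambda>i. take (Suc r) (b i)) ` {..<Suc k} \<subseteq> ?T" by auto
    moreover have "inj_on (\<lambda>i. take (Suc r) (b i)) {..<Suc k}"
    proof (rule inj_onI)
      fix i j assume ij: "i \<in> {..<Suc k}" "j \<in> {..<Suc k}" "take (Suc r) (b i) = take (Suc r) (b j)"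
      then have "b i ! r = b j ! r" by (metis lessI nth_take)
      then show "i = j" using b(2) ij unfolding spread_def by auto
    qed
    moreover have "take r (b 0) \<in> S"
      by (rule closed[OF take_is_prefix]) (use b(1) sub in auto)
    then have "finite ?T" "card ?T \<le> k"
      using S unfolding k_tree_def by blast+
    ultimately show False
      using card_mono[of ?T] by (metis card_image card_lessThan not_less_eq_eq order_trans)
  qed
  then obtain j where j: "str e j \<notin> S" by blast
  \<comment> \<open>\<open>str e j\<close> is an initial segment of \<open>A\<close> outside
    \<open>S\<close>, whereas a path has all its initial segments in the tree.\<close>
  have "\<not> is_path A S" if "through A (cone e j)" for A
    using through_cone[OF e that] j unfolding is_path_def initial_def by metis
  then show ?thesis using condition_cone[OF e] strs_cone_subset by blast
qed

section \<open>Levels of splitting strings\<close>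

text \<open>A level is coded by \<open>(l, r, a)\<close>: the strings with the indices coded in \<open>a\<close> all decide the
  first \<open>l\<close> values, and the families of their children of the same parent spread at the
  lengths coded in \<open>r\<close>. Level \<open>s\<close> has \<open>fact s\<close> members, and \<open>k div Suc s\<close> is the parent of
  member \<open>k\<close> of level \<open>Suc s\<close>.\<close>

definition depth :: "nat \<Rightarrow> nat" where
  "depth c = fst' c"

definition spread_at :: "nat \<Rightarrow> nat \<Rightarrow> nat" where
  "spread_at c i = entry (fst' (snd' c)) i"

text \<open>Storing indices into the enumeration instead of strings makes membership in
  \<open>strs e\<close> automatic, where it might be undecidable.\<close>

definition member :: "(nat \<Rightarrow> nat) \<Rightarrow> nat \<Rightarrow> nat \<Rightarrow> nat" where
  "member e c k = e (entry (snd' (snd' c)) k)"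

definition next_level :: "prog \<Rightarrow> (nat \<Rightarrow> nat) \<Rightarrow> nat \<Rightarrow> nat \<Rightarrow> nat \<Rightarrow> bool" where
  "next_level p e s c c' \<longleftrightarrow> depth c < depth c' \<and>
     (\<forall>k<fact s * Suc s. \<forall>x<depth c'. ev p (str (member e c') k) x \<noteq> 0) \<and>
     separated {..<fact s * Suc s} (depth c') (\<lambda>k. ev p (str (member e c') k)) \<and>
     binary {..<fact s * Suc s} (depth c') (\<lambda>k. ev p (str (member e c') k)) \<and>
     (\<forall>k<fact s * Suc s. prefix (str (member e c) (k div Suc s)) (str (member e c') k)) \<and>
     (\<forall>i<fact s. spread (Suc s) (spread_at c' i) (\<lambda>j. str (member e c') (i * Suc s + j)))"

section \<open>Deciding and coding levels\<close>

lemma prod_encode_0: "prod_encode (0, 0) = 0"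
  by (simp add: prod_encode_def)

lemma prod_decode_0: "prod_decode 0 = (0, 0)"
  using prod_encode_inverse[of "(0, 0)"] by (simp only: prod_encode_0)

text \<open>\<open>entry\<close> agrees with list access only inside the string; the length clause
  of \<open>spread\<close> guarantees this for all positions up to \<open>r\<close>.\<close>

lemma spread_iff_entry:
  "spread N r (\<lambda>j. list_decode (h j)) \<longleftrightarrow> (\<forall>i<N. r < len (h i)) \<and>
    (\<forall>i<N. \<forall>j<N. i \<noteq> j \<longrightarrow> (\<forall>x<r. entry (h i) x = entry (h j) x) \<and> entry (h i) r \<noteq> entry (h j) r)"
proof (cases "\<forall>i<N. r < len (h i)")
  case True
  then have eq: "list_decode (h i) ! x = entry (h i) x" if "i < N" "x \<le> r" for i x
    using that by (intro entry_nth[symmetric]) (simp add: order_le_less_trans)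
  have "(\<forall>x<r. list_decode (h i) ! x = list_decode (h j) ! x) \<and> list_decode (h i) ! r \<noteq> list_decode (h j) ! r
      \<longleftrightarrow> (\<forall>x<r. entry (h i) x = entry (h j) x) \<and> entry (h i) r \<noteq> entry (h j) r" if "i < N" "j < N" for i j
    using eq[OF that(1)] eq[OF that(2)] by simp
  then show ?thesis unfolding spread_def len_def by blast
qed (auto simp: spread_def len_def)

text \<open>Once the definitions are unfolded, every quantifier is bounded by a computable
  term.\<close>

lemma decidable_next_level:
  assumes e: "computable e"
  shows "decidable2 (\<lambda>z y. next_level p e (fst' z) (snd' z) y)"
proof -
  note [comp_intros] = computable_comp[OF e]
  show ?thesis
    unfolding next_level_def separated_def binary_def spread_iff_entry depth_def spread_at_def
      member_def Ball_def lessThan_iff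
    by (intro comp_intros | simp only: decidable2_def)+
qed

lemma entry_list_encode: "k < length xs \<Longrightarrow> entry (list_encode xs) k = xs ! k"
  by (simp add: entry_nth len_def)

lemma ex_level_code:
  fixes a' :: "nat \<Rightarrow> nat list"
  assumes "\<forall>k<n. a' k \<in> strs e"
  shows "\<exists>c. depth c = l \<and> (\<forall>i<m. spread_at c i = r i) \<and> (\<forall>k<n. str (member e c) k = a' k)"
proof -
  have "\<exists>i. str e i = a' k" if "k < n" for k
    using assms[rule_format, OF that] by (metis rangeE)
  then obtain g where g: "\<forall>k<n. str e (g k) = a' k" by metis
  define c where "c = prod_encode (l, prod_encode (list_encode (map r [0..<m]), list_encode (map g [0..<n])))"
  show ?thesis
    using g by (intro exI[of _ c]) (simp add: c_def depth_def spread_at_def member_def entry_list_encode)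
qed

text \<open>The starting code has depth 0, and since \<open>entry 0 0\<close> is 0 its only member
  is \<open>e 0\<close>, in accordance with \<open>fact 0 = 1\<close>.\<close>

primrec level :: "prog \<Rightarrow> (nat \<Rightarrow> nat) \<Rightarrow> nat \<Rightarrow> nat" where
  "level p e 0 = prod_encode (0, prod_encode (0, 0))"
| "level p e (Suc s) = (LEAST c. next_level p e s (level p e s) c)"

text \<open>The value on codes \<open>prod_encode (s, k)\<close> with \<open>k \<ge> fact s\<close> only serves to make this total.\<close>

definition level_strings :: "prog \<Rightarrow> (nat \<Rightarrow> nat) \<Rightarrow> nat \<Rightarrow> nat" where
  "level_strings p e i = (if snd' i < fact (fst' i) then member e (level p e (fst' i)) (snd' i) else e 0)"

lemma fact_Suc': "fact (Suc s) = (fact s * Suc s :: nat)"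
  by (simp add: mult.commute)

lemma child_less: "i < fact s \<Longrightarrow> j < Suc s \<Longrightarrow> i * Suc s + j < fact (Suc s)"
proof -
  assume i: "i < fact s" and "j < Suc s"
  then have "i * Suc s + j < Suc i * Suc s" by simp
  also have "\<dots> \<le> fact s * Suc s" using i by (intro mult_le_mono1) simp
  finally show ?thesis by (simp only: fact_Suc')
qed

locale splitting_condition = splitting "strs e" "ev p" for e p +
  assumes cond: "condition e"
begin

abbreviation node :: "nat \<Rightarrow> nat \<Rightarrow> nat list" where
  "node s k \<equiv> str (member e (level p e s)) k"

abbreviation dep :: "nat \<Rightarrow> nat" where
  "dep s \<equiv> depth (level p e s)"

lemma node_in: "node s k \<in> strs e"
  by (simp add: member_def)

lemma node_0: "node 0 0 = str e 0"
  by (simp add: member_def entry_def tl_code_def prod_decode_0)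

lemma ex_next_level_code:
  assumes "good {..<fact s} (depth c) (\<lambda>k. str (member e c) k)"
  shows "\<exists>c'. next_level p e s c c'"
proof -
  from ex_next_level[OF assms, of "Suc s"] obtain l' rs a' where
    a': "depth c < l'" "good {..<fact s * Suc s} l' a'"
      "\<forall>k<fact s * Suc s. prefix (str (member e c) (k div Suc s)) (a' k)"
      "\<forall>i<fact s. spread (Suc s) (rs i) (\<lambda>j. a' (i * Suc s + j))"
    by blast
  from a'(2) have "\<forall>k<fact s * Suc s. a' k \<in> strs e" by (simp add: good_def)
  from ex_level_code[OF this, of l' "fact s" rs] obtain c' where c': "depth c' = l'"
    "\<forall>i<fact s. spread_at c' i = rs i" "\<forall>k<fact s * Suc s. str (member e c') k = a' k" by blast
  have "spread (Suc s) (spread_at c' i) (\<lambda>j. str (member e c') (i * Suc s + j))" if "i < fact s" for i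
  proof -
    have "spread (Suc s) (rs i) (\<lambda>j. a' (i * Suc s + j))" using a'(4) that by blast
    then have "spread (Suc s) (rs i) (\<lambda>j. str (member e c') (i * Suc s + j))"
      \<comment> \<open>With reflexive prefixes \<open>spread_extend\<close> acts as a congruence
        rule for the indices below \<open>Suc s\<close>.\<close>
      by (rule spread_extend) (use c'(3) child_less[OF that, unfolded fact_Suc'] in \<open>metis prefix_order.order_refl\<close>)
    then show ?thesis using c'(2) that by simp
  qed
  moreover have "\<forall>k<fact s * Suc s. \<forall>x<l'. ev p (str (member e c') k) x \<noteq> 0"
    using a'(2) c'(3) by (auto simp: good_def defd_def)
  moreover have "separated {..<fact s * Suc s} l' (\<lambda>k. ev p (str (member e c') k))"
    using a'(2) c'(3) unfolding good_def separated_def by (metis lessThan_iff)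
  moreover have "binary {..<fact s * Suc s} l' (\<lambda>k. ev p (str (member e c') k))"
  proof -
    have "binary {..<fact s * Suc s} l' (\<lambda>k. ev p (a' k))" using a'(2) by (simp add: good_def)
    then show ?thesis using c'(3) unfolding binary_def by simp
  qed
  ultimately have "next_level p e s c c'"
    unfolding next_level_def c'(1) using a'(1,3) c'(3) by simp
  then show ?thesis ..
qed

text \<open>A next level is known to exist only above a good one, so goodness is carried along with
  the search. Level 0 has one member and depth 0, which leaves only its membership in
  \<open>strs e\<close> to check.\<close>

lemma good_level: "good {..<fact s} (dep s) (node s)"
proof (induction s)
  case 0
  show ?case
    unfolding good_def separated_def binary_def defd_def
    using node_in by (simp add: depth_def member_def)
next
  case (Suc s)
  have "next_level p e s (level p e s) (level p e (Suc s))"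
    unfolding level.simps by (rule LeastI_ex) (rule ex_next_level_code[OF Suc])
  then show ?case
    using node_in unfolding next_level_def good_def defd_def by (simp only: fact_Suc mult.commute) auto
qed

lemma next_level_level: "next_level p e s (level p e s) (level p e (Suc s))"
  unfolding level.simps by (rule LeastI_ex) (rule ex_next_level_code[OF good_level])

text \<open>The search for a next level is guaranteed to end at the levels already built, which is
  the situation of \<open>computable_iterated_Least\<close>.\<close>

lemma computable_level: "computable (level p e)"
proof (rule computable_iterated_Least)
  show "decidable2 (\<lambda>z y. next_level p e (fst' z) (snd' z) y)"
    using cond by (intro decidable_next_level) (simp add: condition_def)
  show "\<exists>y. next_level p e n (level p e n) y" for n
    by (rule ex_next_level_code[OF good_level])
qed simp

section \<open>Ancestors and descendants between levels\<close>

lemma node_parent: "k < fact (Suc s) \<Longrightarrow> prefix (node s (k div Suc s)) (node (Suc s) k)"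
  using next_level_level[of s] unfolding next_level_def fact_Suc' by blast

lemma parent_less: "k < fact (Suc s) \<Longrightarrow> k div Suc s < fact s"
  unfolding fact_Suc' by (simp add: less_mult_imp_div_less)

lemma node_ancestor: "s \<le> t \<Longrightarrow> k < fact t \<Longrightarrow> \<exists>k'<fact s. prefix (node s k') (node t k)"
proof (induction t arbitrary: k rule: dec_induct)
  case base
  then show ?case by blast
next
  case (step t)
  from step.IH[OF parent_less[OF step.prems]] node_parent[OF step.prems] show ?case
    using prefix_order.trans by blast
qed

lemma node_descendant: "s \<le> t \<Longrightarrow> k < fact s \<Longrightarrow> \<exists>k'<fact t. prefix (node s k) (node t k')"
proof (induction t rule: dec_induct)
  case base
  then show ?case by blast
next
  case (step t)
  then obtain i where i: "i < fact t" "prefix (node s k) (node t i)" by blast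
  have "i * Suc t + 0 < fact (Suc t)" by (rule child_less[OF i(1)]) simp
  moreover from node_parent[OF this] have "prefix (node t i) (node (Suc t) (i * Suc t + 0))"
    by (simp del: mult_Suc_right)
  ultimately show ?case using i(2) prefix_order.trans by blast
qed

text \<open>Depths grow strictly, so level \<open>n\<close> decides at least the first
  \<open>n\<close> values.\<close>

lemma dep_ge: "s \<le> dep s"
proof (induction s)
  case (Suc s)
  then show ?case using next_level_level[of s] unfolding next_level_def by simp
qed simp

section \<open>The levels as a smaller condition\<close>

lemma str_level_strings: "k < fact s \<Longrightarrow> str (level_strings p e) (prod_encode (s, k)) = node s k"
  by (simp add: level_strings_def)

lemma level_strings_0: "str (level_strings p e) 0 = str e 0"
  using str_level_strings[of 0 0] node_0 by (simp add: prod_encode_0)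

lemma strs_level_stringsE:
  assumes "\<sigma> \<in> strs (level_strings p e)"
  obtains s k where "k < fact s" "\<sigma> = node s k"
proof -
  obtain i where i: "\<sigma> = str (level_strings p e) i" using assms by blast
  show ?thesis
  proof (cases "snd' i < fact (fst' i)")
    case True
    then show ?thesis using that[of "snd' i" "fst' i"] i by (simp add: level_strings_def)
  next
    case False
    then show ?thesis using that[of 0 0] i node_0 by (simp add: level_strings_def)
  qed
qed

lemma node_in_level_strings: "k < fact s \<Longrightarrow> node s k \<in> strs (level_strings p e)"
  using str_level_strings by (metis rangeI)

lemma level_strings_subset: "strs (level_strings p e) \<subseteq> strs e"
proof
  fix \<sigma> assume "\<sigma> \<in> strs (level_strings p e)"
  then obtain s k where "\<sigma> = node s k" by (rule strs_level_stringsE)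
  then show "\<sigma> \<in> strs e" by (simp only: node_in)
qed

text \<open>For the fan property, a string of level \<open>s\<close> is followed to a descendant on
  a level \<open>t \<ge> N\<close>, whose \<open>Suc t\<close> children are spread; the first
  \<open>N\<close> of them suffice.\<close>

lemma condition_level_strings: "condition (level_strings p e)"
proof -
  have e: "computable e" using cond by (simp add: condition_def)
  note [comp_intros] = computable_comp[OF e] computable_comp[OF computable_level]
  have "computable (level_strings p e)"
    unfolding level_strings_def member_def by (intro comp_intros)
  moreover have "prefix (str (level_strings p e) 0) (str (level_strings p e) i)" for i
  proof -
    have "str (level_strings p e) i \<in> strs e" using level_strings_subset by blast
    then show ?thesis unfolding level_strings_0 using cond unfolding condition_def by auto
  qed
  moreover have "fan (strs (level_strings p e))"
    unfolding fan_def
  proof (intro ballI allI)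
    fix \<sigma> N assume "\<sigma> \<in> strs (level_strings p e)"
    then obtain s k where k: "k < fact s" "\<sigma> = node s k" by (rule strs_level_stringsE)
    define t where "t = max s N"
    obtain i where i: "i < fact t" "prefix \<sigma> (node t i)"
      using node_descendant[of s t k] k by (auto simp: t_def)
    have "spread (Suc t) (spread_at (level p e (Suc t)) i) (\<lambda>j. node (Suc t) (i * Suc t + j))"
      using next_level_level[of t] i(1) unfolding next_level_def by blast
    then have "spread N (spread_at (level p e (Suc t)) i) (\<lambda>j. node (Suc t) (i * Suc t + j))"
      by (rule spread_reindex[of _ _ _ "\<lambda>j. j"]) (auto simp: t_def)
    moreover have "node (Suc t) (i * Suc t + j) \<in> strs (level_strings p e) \<and>
        prefix \<sigma> (node (Suc t) (i * Suc t + j))" if "j < N" for j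
    proof -
      have j: "j < Suc t" using that by (simp add: t_def)
      note less = child_less[OF i(1) j]
      have "(i * Suc t + j) div Suc t = i" using j by (metis add.commute add_0 div_less div_mult_self3 nat.simps(3))
      then have "prefix (node t i) (node (Suc t) (i * Suc t + j))"
        using node_parent[OF less] by simp
      then show ?thesis using node_in_level_strings[OF less] i(2) prefix_order.trans by blast
    qed
    ultimately show "\<exists>b r. (\<forall>i<N. b i \<in> strs (level_strings p e) \<and> prefix \<sigma> (b i)) \<and> spread N r b"
      by (intro exI[of _ "\<lambda>j. node (Suc t) (i * Suc t + j)"]
          exI[of _ "spread_at (level p e (Suc t)) i"]) blast
  qed
  ultimately show ?thesis unfolding condition_def by blast
qed

text \<open>Strings of length \<open>n\<close> are compared with level \<open>n\<close> alone, which
  has finitely many members and decides the first \<open>n\<close> values. This makes membership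
  decidable.\<close>

definition value_tree :: "nat list set" where
  "value_tree = {\<mu>. \<exists>k<fact (length \<mu>). \<forall>x<length \<mu>. Suc (\<mu> ! x) = ev p (node (length \<mu>) k) x}"

lemma computable_value_tree: "computable_strings value_tree"
proof -
  have e: "computable e" using cond by (simp add: condition_def)
  note [comp_intros] = computable_comp[OF e] computable_comp[OF computable_level]
  have iff: "list_decode n \<in> value_tree \<longleftrightarrow>
    (\<exists>k<fact (len n). \<forall>x<len n. Suc (entry n x) = ev p (node (len n) k) x)" for n
    unfolding value_tree_def by (simp add: entry_nth) (simp add: len_def)
  have "decidable (\<lambda>n. list_decode n \<in> value_tree)"
    unfolding iff member_def by (intro comp_intros | simp only: decidable2_def)+
  then show ?thesis unfolding computable_strings_def decidable_def .
qed

lemma node_defd: "k < fact s \<Longrightarrow> x < dep s \<Longrightarrow> ev p (node s k) x \<noteq> 0"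
  using good_level[of s] unfolding good_def defd_def by blast

lemma node_le_3: "ev p (node s k) x \<le> 3"
  using bound node_in by blast

lemma value_tree_subset: "value_tree \<subseteq> lists {..<3}"
proof
  fix \<mu> assume "\<mu> \<in> value_tree"
  then obtain k where k: "\<forall>x<length \<mu>. Suc (\<mu> ! x) = ev p (node (length \<mu>) k) x"
    unfolding value_tree_def by blast
  have "\<mu> ! x < 3" if "x < length \<mu>" for x
    using k that node_le_3[of "length \<mu>" k x] by (metis Suc_le_eq)
  then show "\<mu> \<in> lists {..<3}" by (auto simp: in_set_conv_nth)
qed

text \<open>A shorter string is tested on an earlier level; the ancestor there already decides these
  values, and monotonicity makes them the same.\<close>

lemma value_tree_is_tree: "is_tree value_tree"
  unfolding is_tree_def
proof (intro allI impI)
  fix s t assume "s @ t \<in> value_tree"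
  then obtain k where k: "k < fact (length (s @ t))"
    "\<forall>x<length (s @ t). Suc ((s @ t) ! x) = ev p (node (length (s @ t)) k) x"
    unfolding value_tree_def by blast
  from node_ancestor[OF _ k(1), of "length s"] obtain k' where
    k': "k' < fact (length s)" "prefix (node (length s) k') (node (length (s @ t)) k)" by auto
  have "Suc (s ! x) = ev p (node (length s) k') x" if x: "x < length s" for x
  proof -
    have "Suc (s ! x) = ev p (node (length (s @ t)) k) x"
      using k(2)[rule_format, of x] x by (simp add: nth_append)
    also have "\<dots> = ev p (node (length s) k') x"
      using mono[OF k'(2) node_defd[OF k'(1)]] x dep_ge[of "length s"] by simp
    finally show ?thesis .
  qed
  then show "s \<in> value_tree" unfolding value_tree_def using k'(1) by blast
qed

text \<open>Three successors would come from three members of level \<open>Suc n\<close> that agree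
  below \<open>n\<close> and take three values at \<open>n\<close>. Since \<open>n\<close> is below
  the depth of that level, \<open>binary\<close> forbids this.\<close>

lemma value_tree_not_three:
  assumes "\<mu> @ [0] \<in> value_tree" "\<mu> @ [1] \<in> value_tree" "\<mu> @ [2] \<in> value_tree"
  shows False
proof -
  define n where "n = length \<mu>"
  have "\<exists>k<fact (Suc n). (\<forall>x<n. ev p (node (Suc n) k) x = Suc (\<mu> ! x)) \<and> ev p (node (Suc n) k) n = Suc i"
    if i: "\<mu> @ [i] \<in> value_tree" for i
  proof -
    obtain k where k: "k < fact (Suc n)" "\<forall>x<Suc n. Suc ((\<mu> @ [i]) ! x) = ev p (node (Suc n) k) x"
      using i unfolding value_tree_def n_def by auto
    have "Suc (\<mu> ! x) = ev p (node (Suc n) k) x" if "x < n" for x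
      using k(2)[rule_format, of x] that by (simp add: nth_append n_def)
    moreover have "Suc i = ev p (node (Suc n) k) n"
      using k(2)[rule_format, of n] by (simp add: nth_append n_def)
    ultimately show ?thesis using k(1) by metis
  qed
  from this[OF assms(1)] this[OF assms(2)] this[OF assms(3)] obtain i j k where
    ijk: "i < fact (Suc n)" "j < fact (Suc n)" "k < fact (Suc n)"
    "\<forall>x<n. ev p (node (Suc n) i) x = Suc (\<mu> ! x)" "ev p (node (Suc n) i) n = Suc 0"
    "\<forall>x<n. ev p (node (Suc n) j) x = Suc (\<mu> ! x)" "ev p (node (Suc n) j) n = Suc 1"
    "\<forall>x<n. ev p (node (Suc n) k) x = Suc (\<mu> ! x)" "ev p (node (Suc n) k) n = Suc 2"
    by blast
  have "n < dep (Suc n)" using dep_ge[of "Suc n"] by simp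
  moreover have "binary {..<fact (Suc n)} (dep (Suc n)) (\<lambda>k. ev p (node (Suc n) k))"
    using good_level[of "Suc n"] unfolding good_def by blast
  moreover have "\<forall>y<n. ev p (node (Suc n) i) y = ev p (node (Suc n) j) y \<and>
      ev p (node (Suc n) j) y = ev p (node (Suc n) k) y"
    using ijk(4,6,8) by simp
  ultimately have "ev p (node (Suc n) i) n = ev p (node (Suc n) j) n \<or>
      ev p (node (Suc n) i) n = ev p (node (Suc n) k) n \<or> ev p (node (Suc n) j) n = ev p (node (Suc n) k) n"
    using ijk(1-3) binaryD[of "{..<fact (Suc n)}" "dep (Suc n)" "\<lambda>k. ev p (node (Suc n) k)" i j k n]
    by blast
  then show False using ijk(5,7,9) by simp
qed

text \<open>A descendant on the next level keeps the first \<open>n\<close> values and decides value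
  number \<open>n\<close> as well.\<close>

lemma ex_value_tree_succ:
  assumes "\<mu> \<in> value_tree"
  shows "\<exists>i. \<mu> @ [i] \<in> value_tree"
proof -
  define n where "n = length \<mu>"
  obtain k where k: "k < fact n" "\<forall>x<n. Suc (\<mu> ! x) = ev p (node n k) x"
    using assms unfolding value_tree_def n_def by blast
  obtain k' where k': "k' < fact (Suc n)" "prefix (node n k) (node (Suc n) k')"
    using node_descendant[of n "Suc n" k] k(1) by auto
  \<comment> \<open>Subtracting 1 undoes the shift of \<open>ev\<close>; the result is nonzero
    because the depth of level \<open>Suc n\<close> exceeds \<open>n\<close>.\<close>
  have "Suc ((\<mu> @ [ev p (node (Suc n) k') n - 1]) ! x) = ev p (node (Suc n) k') x" if x: "x < Suc n" for x
  proof (cases "x = n")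
    case True
    have "ev p (node (Suc n) k') n \<noteq> 0"
      using node_defd[OF k'(1)] dep_ge[of "Suc n"] by simp
    then show ?thesis using True by (simp add: n_def nth_append)
  next
    case False
    with x have x: "x < n" by simp
    have "ev p (node (Suc n) k') x = ev p (node n k) x"
      using mono[OF k'(2) node_defd[OF k(1)]] x dep_ge[of n] by simp
    then show ?thesis using k(2) x by (simp add: n_def nth_append)
  qed
  moreover have "length (\<mu> @ [i]) = Suc n" for i by (simp add: n_def)
  ultimately have "\<mu> @ [ev p (node (Suc n) k') n - 1] \<in> value_tree"
    unfolding value_tree_def mem_Collect_eq using k'(1) by metis
  then show ?thesis ..
qed

lemma value_tree_branching: "k_branching_tree 2 value_tree"
  unfolding k_branching_tree_def
proof (intro conjI ballI value_tree_is_tree)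
  fix \<mu> assume \<mu>: "\<mu> \<in> value_tree"
  let ?T = "immediate_succs value_tree \<mu>" and ?U = "(\<lambda>i. \<mu> @ [i]) ` {..<3}"
  have sub: "?T \<subseteq> ?U"
    using value_tree_subset unfolding immediate_succs_def by fastforce
  then show fin: "finite ?T" by (rule finite_subset) simp
  have U: "card ?U = 3" by (subst card_image) (auto simp: inj_on_def)
  have "?T \<noteq> ?U"
  proof
    assume "?T = ?U"
    then have "\<mu> @ [i] \<in> value_tree" if "i < 3" for i
      using that unfolding immediate_succs_def by blast
    then show False using value_tree_not_three[of \<mu>] by simp
  qed
  with sub U have "card ?T < 3" by (metis finite_imageI finite_lessThan psubsetI psubset_card_mono)
  moreover have "?T \<noteq> {}"
    using ex_value_tree_succ[OF \<mu>] unfolding immediate_succs_def by blast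
  then have "card ?T \<noteq> 0" using fin by simp
  ultimately show "card ?T = 1 \<or> card ?T = 2" by linarith
qed

text \<open>A sufficiently long initial segment of \<open>A\<close> in the condition comes from
  level \<open>n\<close> or later. Its ancestor on level \<open>n\<close> is again an initial
  segment of \<open>A\<close> and decides the first \<open>n\<close> values, which are those of
  \<open>f\<close>.\<close>

lemma value_tree_path:
  assumes A: "through A (level_strings p e)" and f: "\<And>x. halts_with A p x (f x)"
  shows "is_path f value_tree"
  unfolding is_path_def
proof
  fix n
  \<comment> \<open>The levels up to \<open>n\<close> contain finitely many strings, so a string
    longer than all of them belongs to a later level.\<close>
  have "finite (\<Union>s\<le>n. (\<lambda>k. length (node s k)) ` {..<fact s})" by simp
  then obtain B where B: "\<And>s k. s \<le> n \<Longrightarrow> k < fact s \<Longrightarrow> length (node s k) \<le> B"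
    unfolding finite_nat_set_iff_bounded_le by blast
  obtain \<sigma> where \<sigma>: "\<sigma> \<in> strs (level_strings p e)" "Suc B \<le> length \<sigma>" "initial \<sigma> A"
    using A unfolding through_def by blast
  obtain t k where t: "k < fact t" "\<sigma> = node t k" using \<sigma>(1) by (rule strs_level_stringsE)
  have "n \<le> t"
  proof (rule ccontr)
    assume "\<not> n \<le> t"
    then show False using B[of t k] t \<sigma>(2) by simp
  qed
  from node_ancestor[OF this t(1)] obtain k' where k': "k' < fact n" "prefix (node n k') \<sigma>"
    using t(2) by blast
  have "ev p (node n k') x = Suc (f x)" if "x < n" for x
    using ev_initial[OF f initial_prefix[OF \<sigma>(3) k'(2)] node_defd[OF k'(1)]] that dep_ge[of n] by simp
  then show "map f [0..<n] \<in> value_tree"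
    unfolding value_tree_def using k'(1) by auto
qed

end

section \<open>The generic function\<close>

text \<open>This is the failure of the tree clause of \<open>two_surviving\<close>.\<close>

definition on_binary_tree :: "(nat \<Rightarrow> nat) \<Rightarrow> bool" where
  "on_binary_tree f \<longleftrightarrow>
    (\<exists>T. T \<subseteq> lists {..<3} \<and> k_branching_tree 2 T \<and> computable_strings T \<and> is_path f T)"

text \<open>The tree consists of the initial segments of \<open>f\<close> alone. Each node has
  exactly one successor, which a 2-branching tree permits.\<close>

lemma computable_on_binary_tree:
  assumes f: "computable f" and less: "\<And>x. f x < 3"
  shows "on_binary_tree f"
proof -
  define T where "T = {\<mu>. initial \<mu> f}"
  note [comp_intros] = computable_comp[OF f]
  have "list_decode n \<in> T \<longleftrightarrow> (\<forall>x<len n. entry n x = f x)" for n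
    unfolding T_def initial_iff_nth by (simp add: entry_nth) (simp add: len_def)
  moreover have "decidable (\<lambda>n. \<forall>x<len n. entry n x = f x)"
    by (intro comp_intros | simp only: decidable2_def)+
  ultimately have "computable_strings T"
    unfolding computable_strings_def decidable_def by simp
  moreover have "T \<subseteq> lists {..<3}"
    using less by (auto simp: T_def initial_iff_nth in_set_conv_nth)
  moreover have "is_path f T"
    by (simp add: is_path_def T_def initial_iff_nth)
  moreover have "k_branching_tree 2 T"
    unfolding k_branching_tree_def
  proof (intro conjI ballI)
    show "is_tree T"
      unfolding is_tree_def T_def using initial_prefix by (auto simp: prefix_def)
    fix \<mu> assume "\<mu> \<in> T"
    then have "immediate_succs T \<mu> = {\<mu> @ [f (length \<mu>)]}"
      unfolding immediate_succs_def T_def initial_iff_nth by (auto simp: nth_append less_Suc_eq)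
    then show "finite (immediate_succs T \<mu>)"
      "card (immediate_succs T \<mu>) = 1 \<or> card (immediate_succs T \<mu>) = 2" by simp_all
  qed
  ultimately show ?thesis unfolding on_binary_tree_def by blast
qed

text \<open>To compute \<open>f x\<close>, search the enumeration for any string on which
  \<open>p\<close> gives a value at \<open>x\<close>. Some initial segment of \<open>A\<close> gives
  the true value, and by agreement the string found gives the same one.\<close>

lemma computable_if_not_splitting:
  assumes e: "condition e" and A: "through A e" and f: "\<And>x. halts_with A p x (f x)"
    and agree: "\<And>i j x. ev p (str e i) x \<noteq> 0 \<Longrightarrow> ev p (str e j) x \<noteq> 0 \<Longrightarrow> ev p (str e i) x = ev p (str e j) x"
  shows "computable f"
proof -
  have ex: "\<exists>i. ev p (str e i) x = Suc (f x)" for x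
    using ev_initial_long[OF f A] by blast
  define g where "g = (\<lambda>x. LEAST i. ev p (str e i) x \<noteq> 0)"
  have ce: "computable e" using e by (simp add: condition_def)
  note [comp_intros] = computable_comp[OF ce]
  have "computable g"
    unfolding g_def
  proof (rule computable_Least)
    show "decidable2 (\<lambda>x i. ev p (str e i) x \<noteq> 0)"
      by (simp only: decidable2_def) (intro comp_intros)
    show "\<exists>i. ev p (str e i) x \<noteq> 0" for x using ex[of x] by (metis nat.distinct(1))
  qed
  then have "computable (\<lambda>x. ev p (str e (g x)) x - 1)"
    by (intro comp_intros)
  moreover have "ev p (str e (g x)) x = Suc (f x)" for x
  proof -
    obtain i where i: "ev p (str e i) x = Suc (f x)" using ex by blast
    have "ev p (str e (g x)) x \<noteq> 0"
      unfolding g_def by (rule LeastI[of _ i]) (simp add: i)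
    then show ?thesis using agree[of i x "g x"] i by simp
  qed
  ultimately show ?thesis by simp
qed

lemma force_on_binary_tree:
  assumes e: "condition e"
  shows "\<exists>e'. condition e' \<and> strs e' \<subseteq> strs e \<and>
    (\<forall>A f. through A e' \<longrightarrow> (\<forall>x. halts_with A p x (f x) \<and> f x < 3) \<longrightarrow> on_binary_tree f)"
proof -
  have cone: ?thesis if "\<And>A f. through A (cone e j) \<Longrightarrow> (\<And>x. halts_with A p x (f x)) \<Longrightarrow>
      (\<And>x. f x < 3) \<Longrightarrow> on_binary_tree f" for j
    using that condition_cone[OF e] strs_cone_subset by (intro exI[of _ "cone e j"]) blast
  \<comment> \<open>Results are shifted by one, so \<open>3 < ev p\<close> means a value of at least
    3. In the first two cases the cone leaves no \<open>f\<close> of the required kind.\<close>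
  consider (diverge) "\<exists>j x. \<forall>\<tau>\<in>strs (cone e j). ev p \<tau> x = 0"
    | (large) "\<exists>j x. 3 < ev p (str e j) x"
    | (agree) "\<exists>j. \<forall>\<tau>\<in>strs (cone e j). \<forall>\<upsilon>\<in>strs (cone e j). \<forall>x.
        ev p \<tau> x \<noteq> 0 \<longrightarrow> ev p \<upsilon> x \<noteq> 0 \<longrightarrow> ev p \<tau> x = ev p \<upsilon> x"
    | (split) "\<not> (\<exists>j x. \<forall>\<tau>\<in>strs (cone e j). ev p \<tau> x = 0)"
        "\<not> (\<exists>j x. 3 < ev p (str e j) x)"
        "\<not> (\<exists>j. \<forall>\<tau>\<in>strs (cone e j). \<forall>\<upsilon>\<in>strs (cone e j). \<forall>x.
          ev p \<tau> x \<noteq> 0 \<longrightarrow> ev p \<upsilon> x \<noteq> 0 \<longrightarrow> ev p \<tau> x = ev p \<upsilon> x)"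
    by argo
  then show ?thesis
  proof cases
    case diverge
    then obtain j x where div: "\<forall>\<tau>\<in>strs (cone e j). ev p \<tau> x = 0" by blast
    show ?thesis
    proof (rule cone[of j])
      fix A f assume A: "through A (cone e j)" and f: "\<And>x. halts_with A p x (f x)"
      show "on_binary_tree f" using ev_initial_long[OF f A, of 0 x] div by auto
    qed
  next
    case large
    then obtain j x where big: "3 < ev p (str e j) x" by blast
    show ?thesis
    proof (rule cone[of j])
      fix A f assume A: "through A (cone e j)" and f: "\<And>x. halts_with A p x (f x)" "\<And>x. f x < 3"
      have "ev p (str e j) x = Suc (f x)"
        using ev_initial[OF f(1) through_cone[OF e A]] big by simp
      then show "on_binary_tree f" using big f(2)[of x] by simp
    qed
  next
    case agree
    then obtain j where same: "\<forall>\<tau>\<in>strs (cone e j). \<forall>\<upsilon>\<in>strs (cone e j). \<forall>x.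
        ev p \<tau> x \<noteq> 0 \<longrightarrow> ev p \<upsilon> x \<noteq> 0 \<longrightarrow> ev p \<tau> x = ev p \<upsilon> x" by blast
    show ?thesis
    proof (rule cone[of j])
      fix A f assume A: "through A (cone e j)" and f: "\<And>x. halts_with A p x (f x)" "\<And>x. f x < 3"
      have "computable f"
        by (rule computable_if_not_splitting[OF condition_cone[OF e] A f(1)]) (use same in blast)
      then show "on_binary_tree f" using f(2) by (rule computable_on_binary_tree)
    qed
  next
    case split
    have total: "\<exists>\<tau>\<in>strs (cone e j). ev p \<tau> x \<noteq> 0" for j x
      using split(1) by blast
    have small: "ev p (str e j) x \<le> 3" for j x
      using split(2) not_less by blast
    have differ: "\<exists>\<tau>\<in>strs (cone e j). \<exists>\<upsilon>\<in>strs (cone e j). \<exists>x.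
        ev p \<tau> x \<noteq> 0 \<and> ev p \<upsilon> x \<noteq> 0 \<and> ev p \<tau> x \<noteq> ev p \<upsilon> x" for j
      using split(3) by blast
    interpret splitting_condition e p
    proof
      show "prefix \<sigma> \<tau> \<Longrightarrow> ev p \<sigma> x \<noteq> 0 \<Longrightarrow> ev p \<tau> x = ev p \<sigma> x" for \<sigma> \<tau> x by (rule ev_mono)
      show "fan (strs e)" "condition e" using e by (simp_all add: condition_def)
      fix \<sigma> assume "\<sigma> \<in> strs e"
      then obtain j where j: "\<sigma> = str e j" by blast
      show "ev p \<sigma> x \<le> 3" for x using small j by blast
      show "\<exists>\<tau>\<in>strs e. prefix \<sigma> \<tau> \<and> ev p \<tau> x \<noteq> 0" for x
        using total[of j x] unfolding strs_cone j by blast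
      show "\<exists>\<tau>\<in>strs e. \<exists>\<upsilon>\<in>strs e. \<exists>x. prefix \<sigma> \<tau> \<and> prefix \<sigma> \<upsilon> \<and>
          ev p \<tau> x \<noteq> 0 \<and> ev p \<upsilon> x \<noteq> 0 \<and> ev p \<tau> x \<noteq> ev p \<upsilon> x"
        using differ[of j] unfolding strs_cone j by blast
    qed
    have "on_binary_tree f" if "through A (level_strings p e)" "\<forall>x. halts_with A p x (f x) \<and> f x < 3" for A f
      using value_tree_subset value_tree_branching computable_value_tree value_tree_path[OF that(1), of f] that(2)
      unfolding on_binary_tree_def by blast
    then show ?thesis using condition_level_strings level_strings_subset by blast
  qed
qed

section \<open>Enumerating the requirements\<close>

instance prog :: countable
  by countable_datatype

text \<open>Each program names some set of strings, whether or not it computes a characteristic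
  function, so all computable trees occur in an enumeration of programs.\<close>

definition decided_by :: "prog \<Rightarrow> nat list set" where
  "decided_by p = {\<sigma>. halts_with (\<lambda>_. 0) p (list_encode \<sigma>) 1}"

lemma computable_strings_decided_by:
  assumes "computable_strings S"
  shows "\<exists>p. S = decided_by p"
proof -
  obtain p where p: "\<And>n. halts_with (\<lambda>_. 0) p n (if list_decode n \<in> S then 1 else 0)"
    using assms unfolding computable_strings_def by (rule computableE) blast
  have "\<sigma> \<in> S \<longleftrightarrow> halts_with (\<lambda>_. 0) p (list_encode \<sigma>) 1" for \<sigma>
    using p[of "list_encode \<sigma>"] halts_with_deterministic[OF p[of "list_encode \<sigma>"], of 1]
    by (auto split: if_splits)
  then show ?thesis unfolding decided_by_def by blast
qed

text \<open>One program carries two requirements: it is read as the name of a tree to be avoided and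
  as a functional applied to \<open>A\<close>.\<close>

definition meets :: "prog \<Rightarrow> (nat \<Rightarrow> nat) \<Rightarrow> bool" where
  "meets p A \<longleftrightarrow> (\<forall>k. k_tree k (decided_by p) \<longrightarrow> \<not> is_path A (decided_by p)) \<and>
    (\<forall>f. (\<forall>x. halts_with A p x (f x) \<and> f x < 3) \<longrightarrow> on_binary_tree f)"

text \<open>The two requirements are met in turn, and a final cone lengthens the stem, so that the
  stems of successive conditions grow into a total function.\<close>

lemma ex_meeting_condition:
  assumes e: "condition e"
  shows "\<exists>e'. condition e' \<and> strs e' \<subseteq> strs e \<and> length (str e 0) < length (str e' 0) \<and>
    (\<forall>A. through A e' \<longrightarrow> meets p A)"
proof -
  \<comment> \<open>If the named set is a \<open>k\<close>-tree for no \<open>k\<close>, then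
    \<open>e\<close> itself serves. Otherwise one suitable \<open>k\<close> is enough, since being a
    path does not depend on \<open>k\<close>.\<close>
  obtain e1 where e1: "condition e1" "strs e1 \<subseteq> strs e"
    "\<forall>A k. through A e1 \<longrightarrow> k_tree k (decided_by p) \<longrightarrow> \<not> is_path A (decided_by p)"
    using avoid_k_tree[OF e] e by (cases "\<exists>k. k_tree k (decided_by p)") (meson order_refl)+
  obtain e2 where e2: "condition e2" "strs e2 \<subseteq> strs e1"
    "\<forall>A f. through A e2 \<longrightarrow> (\<forall>x. halts_with A p x (f x) \<and> f x < 3) \<longrightarrow> on_binary_tree f"
    using force_on_binary_tree[OF e1(1)] by blast
  obtain j where j: "length (str e2 0) < length (str e2 j)"
    using ex_longer[OF e2(1)] by blast
  have sub: "strs (cone e2 j) \<subseteq> strs e2" by (rule strs_cone_subset)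
  have "str e2 0 \<in> strs e" using e1(2) e2(2) by blast
  then have "prefix (str e 0) (str e2 0)" using e unfolding condition_def by auto
  then have "length (str e 0) < length (str (cone e2 j) 0)"
    unfolding str_cone_0[OF e2(1)] using prefix_length_le j by fastforce
  moreover have "meets p A" if "through A (cone e2 j)" for A
    using through_mono[OF that sub] through_mono[of A e2 e1] e1(3) e2(2,3) unfolding meets_def by blast
  ultimately show ?thesis
    using condition_cone[OF e2(1)] sub e1(2) e2(2) by (meson order_trans)
qed

lemma condition_id: "condition (\<lambda>i. i)"
proof -
  have "range list_decode = (UNIV :: nat list set)" by (metis list_encode_inverse surjI)
  moreover have "fan UNIV"
    unfolding fan_def
  proof (intro ballI allI)
    fix \<sigma> :: "nat list" and N
    show "\<exists>b r. (\<forall>i<N. b i \<in> UNIV \<and> prefix \<sigma> (b i)) \<and> spread N r b"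
      by (intro exI[of _ "\<lambda>i. \<sigma> @ [i]"] exI[of _ "length \<sigma>"]) (simp add: spread_def nth_append)
  qed
  ultimately show ?thesis by (simp add: condition_def computable_id)
qed

text \<open>\<open>A\<close> is the union of the stems of a descending sequence of conditions. The
  stems of all later stages lie in \<open>strs (e n)\<close> and become arbitrarily long, so
  \<open>A\<close> passes through every condition.\<close>

lemma ex_generic: "\<exists>A. \<forall>p. meets p A"
proof -
  have "\<exists>e. \<forall>n. condition (e n) \<and> (strs (e (Suc n)) \<subseteq> strs (e n) \<and>
      length (str (e n) 0) < length (str (e (Suc n)) 0) \<and>
      (\<forall>A. through A (e (Suc n)) \<longrightarrow> meets (from_nat n) A))"
    using condition_id ex_meeting_condition
    by (intro dependent_nat_choice[of "\<lambda>_. condition"]) blast+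
  then obtain e where e: "\<And>n. condition (e n)" "\<And>n. strs (e (Suc n)) \<subseteq> strs (e n)"
    "\<And>n. length (str (e n) 0) < length (str (e (Suc n)) 0)"
    \<comment> \<open>\<open>from_nat\<close> runs through all programs, so every program is treated
      at some stage.\<close>
    "\<And>n A. through A (e (Suc n)) \<Longrightarrow> meets (from_nat n) A" by blast
  have sub: "strs (e n) \<subseteq> strs (e m)" if "m \<le> n" for m n
    using that by (induction n rule: dec_induct) (use e(2) in blast)+
  have long: "n \<le> length (str (e n) 0)" for n
  proof (induction n)
    case (Suc n)
    then show ?case using e(3)[of n] by linarith
  qed simp
  have pre: "prefix (str (e m) 0) (str (e n) 0)" if "m \<le> n" for m n
  proof -
    have "str (e n) 0 \<in> strs (e m)" using sub[OF that] by blast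
    then show ?thesis using e(1)[of m] unfolding condition_def by auto
  qed
  \<comment> \<open>The stem of stage \<open>Suc x\<close> has length at least \<open>Suc x\<close>,
    so position \<open>x\<close> lies inside it.\<close>
  define A where "A x = str (e (Suc x)) 0 ! x" for x
  have init: "initial (str (e n) 0) A" for n
    unfolding initial_iff_nth
  proof (intro allI impI)
    fix x assume x: "x < length (str (e n) 0)"
    show "str (e n) 0 ! x = A x"
    proof (cases "n \<le> Suc x")
      case True
      then show ?thesis unfolding A_def using nth_prefix[OF pre x] by metis
    next
      case False
      then show ?thesis
        unfolding A_def using nth_prefix[OF pre, of "Suc x" n x] long[of "Suc x"] by simp
    qed
  qed
  have "through A (e n)" for n
    unfolding through_def
  proof
    fix m
    have "str (e (max m n)) 0 \<in> strs (e n)" using sub[of n "max m n"] by auto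
    moreover have "m \<le> length (str (e (max m n)) 0)"
      using long[of "max m n"] by simp
    ultimately show "\<exists>\<sigma>\<in>strs (e n). m \<le> length \<sigma> \<and> initial \<sigma> A" using init by blast
  qed
  then have "meets (from_nat n) A" for n using e(4) by blast
  then have "meets p A" for p by (metis from_nat_to_nat)
  then show ?thesis by blast
qed

theorem theorem3p9:
  "\<exists>d\<in>turing_degrees. globally_tree_surviving_degree d \<and> \<not> two_surviving_degree d"
proof -
  obtain A where A: "\<And>p. meets p A" using ex_generic by blast
  define d where "d = turing_equiv `` {A}"
  have d: "g \<in> d \<longleftrightarrow> A \<le>\<^sub>T g \<and> g \<le>\<^sub>T A" for g
    by (simp add: d_def turing_equiv_def)
  have "globally_tree_surviving A"
    unfolding globally_tree_surviving_def
    using A computable_strings_decided_by unfolding meets_def by blast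
  moreover have "degree_computes d A"
    unfolding degree_computes_def using d turing_le_refl by blast
  ultimately have "globally_tree_surviving_degree d"
    unfolding globally_tree_surviving_degree_def by blast
  moreover have "\<not> two_surviving f" if f: "degree_computes d f" for f
  proof
    assume two: "two_surviving f"
    \<comment> \<open>Every member of the degree is computable from \<open>A\<close>, so
      \<open>f\<close> is computed by a program with oracle \<open>A\<close> itself.\<close>
    from f have "f \<le>\<^sub>T A" unfolding degree_computes_def using d turing_le_trans by blast
    then obtain p where "\<forall>x. halts_with A p x (f x)" unfolding turing_le_def by blast
    then have "on_binary_tree f"
      using two A[of p] unfolding meets_def two_surviving_def by blast
    then show False using two unfolding on_binary_tree_def two_surviving_def by blast
  qed
  then have "\<not> two_surviving_degree d"
    unfolding two_surviving_degree_def by blast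
  moreover have "d \<in> turing_degrees"
    unfolding turing_degrees_def d_def by (simp add: quotientI)
  ultimately show ?thesis by blast
qed

end
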